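(* Consider the stochastic minimax problem $\min_{x\in\mathbb{R}^d}\max_{y\in\mathbb{R}^p} f(x,y)$ with $f(x,y)=\mathbb{E}_{\xi\sim\mathcal{D}}[f(x,y;\xi)]$, and let $F(x)=\max_{y}f(x,y)$. Assume: (A1) there is $\mu>0$ such that for every $x$ the set $\arg\max_y f(x,y)$ is nonempty and $\|\nabla_y f(x,y)\|^2\ge 2\mu\big(\max_{y'}f(x,y')-f(x,y)\big)$ for all $y$; (A2) for every $\xi$, the maps $\nabla_x f(\cdot,\cdot;\xi)$ and $\nabla_y f(\cdot,\cdot;\xi)$ are $L_f$-Lipschitz in each argument separately, i.e. $\|\nabla_x f(x_1,y;\xi)-\nabla_x f(x_2,y;\xi)\|\le L_f\|x_1-x_2\|$, $\|\nabla_x f(x,y_1;\xi)-\nabla_x f(x,y_2;\xi)\|\le L_f\|y_1-y_2\|$, and the same two inequalities with $\nabla_y$ in place of $\nabla_x$, for all $x,x_1,x_2,y,y_1,y_2$; (A3) $\mathbb{E}_\xi[\nabla f(x,y;\xi)]=\nabla f(x,y)$ and $\mathbb{E}_\xi\|\nabla f(x,y)-\nabla f(x,y;\xi)\|^2\le\sigma^2$ for all $x,y$, where $\nabla f=(\nabla_x f,\nabla_y f)$; (A4) $F^*=\inf_x F(x)>-\infty$. Let $\{x_t,y_t,\tilde x_t,w_t,v_t\}$ be generated by the MSGDA algorithm (described in the context) with $\eta_t=\frac{k}{(m+t)^{1/3}}$ for all $t\ge 0$, $\alpha_{t+1}=c_1\eta_t^2$, $\beta_{t+1}=c_2\eta_t^2$,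 where $k>0$, $m\ge\max\big(2,k^3,(c_1k)^3,(c_2k)^3\big)$, $c_1\ge\frac{2}{3k^3}+\frac{9L_f^2}{\mu^2}$, $c_2\ge\frac{2}{3k^3}+\frac94$, $0<\lambda\le\min\big(\frac{3}{4\sqrt2\,\mu},\frac{m^{1/3}}{2L_fk}\big)$ and $0<\gamma\le\min\big(\frac{\lambda\mu}{16L},\frac{1}{2L_f\sqrt{8+9/(8\lambda\mu^2)}}\big)$. Then for every $T\ge1$, $$\frac1T\sum_{t=1}^T\mathbb{E}\|\nabla F(x_t)\|\le\frac1T\sum_{t=1}^T\mathbb{E}[\mathcal{G}_t]\le\frac{2\sqrt{3H}\,m^{1/6}}{T^{1/2}}+\frac{2\sqrt{3H}}{T^{1/3}},$$ where $H=\frac{F(x_1)-F^*}{\gamma k}+\frac{9L_f^2}{k\lambda\mu^2}\Delta_1+\frac{2\sigma^2m^{1/3}}{k^2}+2k^2(c_1^2+c_2^2)\sigma^2\ln(m+T)$ and $\Delta_1=F(x_1)-f(x_1,y_1)$.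
   Context: $\kappa=L_f/\mu$ and $L=L_f(1+\kappa/2)$. For each $x$, $y^*(x)$ denotes an element of $\arg\max_y f(x,y)$, so $F(x)=f(x,y^*(x))$. MSGDA algorithm: given constants $\gamma,\lambda>0$, sequences $\eta_t>0$ and $\alpha_t,\beta_t\in(0,1]$, initial points $x_1\in\mathbb{R}^d,y_1\in\mathbb{R}^p$, and samples $\xi_1,\xi_2,\dots$ drawn i.i.d. from $\mathcal{D}$: set $v_1=\nabla_y f(x_1,y_1;\xi_1)$, $w_1=\nabla_x f(x_1,y_1;\xi_1)$, and for $t\ge1$: $\tilde y_{t+1}=y_t+\lambda v_t$, $\tilde x_{t+1}=x_t-\gamma w_t$; $y_{t+1}=y_t+\eta_t(\tilde y_{t+1}-y_t)$, $x_{t+1}=x_t+\eta_t(\tilde x_{t+1}-x_t)$; $v_{t+1}=\nabla_y f(x_{t+1},y_{t+1};\xi_{t+1})+(1-\alpha_{t+1})[v_t-\nabla_y f(x_t,y_t;\xi_{t+1})]$; $w_{t+1}=\nabla_x f(x_{t+1},y_{t+1};\xi_{t+1})+(1-\beta_{t+1})[w_t-\nabla_x f(x_t,y_t;\xi_{t+1})]$. The metric is $\mathcal{G}_t=\frac1\gamma\|x_t-\tilde x_{t+1}\|+\frac{\sqrt2L_f}{\sqrt\mu}\sqrt{F(x_t)-f(x_t,y_t)}+\|\nabla_x f(x_t,y_t)-w_t\|$. *)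

theory Defs
  imports "HOL-Probability.Probability"
begin

text \<open>Value function F(x) = max_y f(x,y) (written as a supremum; under (A1) it is attained).\<close>
definition Fmax :: "('x \<Rightarrow> 'y \<Rightarrow> real) \<Rightarrow> 'x \<Rightarrow> real" where
  "Fmax f x = (SUP y. f x y)"

definition grad :: "('x::euclidean_space \<Rightarrow> real) \<Rightarrow> 'x \<Rightarrow> 'x" where
  "grad F x = (\<Sum>b\<in>Basis. frechet_derivative F (at x) b *\<^sub>R b)"

text \<open>MSGDA iterates. The state (x_t, y_t, v_t, w_t) at time t = n+1 is msgda ... s n;
  the sample used at time t is xi_t = s !! (t-1). gx xi x y / gy xi x y are the stochastic
  partial gradients nabla_x f(x,y;xi), nabla_y f(x,y;xi).\<close>
fun msgda :: "('a \<Rightarrow> 'x \<Rightarrow> 'y \<Rightarrow> 'x::real_vector) \<Rightarrow> ('a \<Rightarrow> 'x \<Rightarrow> 'y \<Rightarrow> 'y::real_vector)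
    \<Rightarrow> real \<Rightarrow> real \<Rightarrow> (nat \<Rightarrow> real) \<Rightarrow> (nat \<Rightarrow> real) \<Rightarrow> (nat \<Rightarrow> real)
    \<Rightarrow> 'x \<Rightarrow> 'y \<Rightarrow> 'a stream \<Rightarrow> nat \<Rightarrow> 'x \<times> 'y \<times> 'y \<times> 'x" where
  "msgda gx gy \<gamma> lam \<eta> \<alpha> \<beta> x1 y1 s 0 = (x1, y1, gy (s !! 0) x1 y1, gx (s !! 0) x1 y1)"
| "msgda gx gy \<gamma> lam \<eta> \<alpha> \<beta> x1 y1 s (Suc n) =
     (let (x, y, v, w) = msgda gx gy \<gamma> lam \<eta> \<alpha> \<beta> x1 y1 s n;
          t = Suc n;
          yt = y + lam *\<^sub>R v;
          xt = x - \<gamma> *\<^sub>R w;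
          y' = y + \<eta> t *\<^sub>R (yt - y);
          x' = x + \<eta> t *\<^sub>R (xt - x);
          \<xi> = s !! t;
          v' = gy \<xi> x' y' + (1 - \<alpha> (Suc t)) *\<^sub>R (v - gy \<xi> x y);
          w' = gx \<xi> x' y' + (1 - \<beta> (Suc t)) *\<^sub>R (w - gx \<xi> x y)
      in (x', y', v', w'))"

text \<open>Accessors, indexed by t \<ge> 1 as in the paper.\<close>
definition xs where "xs gx gy \<gamma> lam \<eta> \<alpha> \<beta> x1 y1 s t = fst (msgda gx gy \<gamma> lam \<eta> \<alpha> \<beta> x1 y1 s (t - 1))"
definition ys where "ys gx gy \<gamma> lam \<eta> \<alpha> \<beta> x1 y1 s t = fst (snd (msgda gx gy \<gamma> lam \<eta> \<alpha> \<beta> x1 y1 s (t - 1)))"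
definition vs where "vs gx gy \<gamma> lam \<eta> \<alpha> \<beta> x1 y1 s t = fst (snd (snd (msgda gx gy \<gamma> lam \<eta> \<alpha> \<beta> x1 y1 s (t - 1))))"
definition ws where "ws gx gy \<gamma> lam \<eta> \<alpha> \<beta> x1 y1 s t = snd (snd (snd (msgda gx gy \<gamma> lam \<eta> \<alpha> \<beta> x1 y1 s (t - 1))))"

end

theory Submission
  imports Defs
begin

text \<open>
  The Lyapunov function is \<open>F(x) - F\<^sup>* + A (F(x) - f(x,y)) + \<gamma>/\<eta> (\<parallel>\<nabla>\<^sub>x f - w\<parallel>\<^sup>2 + \<parallel>\<nabla>\<^sub>y f - v\<parallel>\<^sup>2)\<close>
  with \<open>A = 9 \<gamma> L\<^sub>f\<^sup>2 / (\<lambda> \<mu>\<^sup>2)\<close>. Conditionally on the past, the two error terms contract up to a noise of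
  order \<open>\<eta>\<^sup>3\<close>, while the PL inequality makes the gap \<open>F(x) - f(x,y)\<close> contract along the ascent step;
  in expectation the Lyapunov function therefore decreases by
  \<open>\<gamma>\<eta>/4 (\<parallel>w\<parallel>\<^sup>2 + 2 L\<^sub>f\<^sup>2/\<mu> (F(x) - f(x,y)) + \<parallel>\<nabla>\<^sub>x f - w\<parallel>\<^sup>2)\<close>, which dominates \<open>\<gamma>\<eta>/12\<close> times the squared
  metric. Telescoping and Cauchy-Schwarz give the rate.

  The paper takes \<open>F\<close> to be smooth with constant \<open>L\<^sub>f(1 + \<kappa>/2)\<close>. The optimal constant in general is
  \<open>L\<^sub>f(1 + \<kappa>)\<close>; the cruder \<open>L\<^sub>f(1 + 2\<kappa>)\<close>, which follows directly from the Lipschitz dependence of the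
  maximisers on \<open>x\<close>, is already compatible with the given range of \<open>\<gamma>\<close>.
\<close>

section \<open>Smoothness and the Polyak-Lojasiewicz inequality\<close>

text \<open>The PL inequality allows several maximisers, so there is no map y*(x) to differentiate.
  Quadratic growth takes its place: each y has a maximiser at a distance controlled by the root of
  the gap. Hence the argmax sets vary in a Lipschitz way, \<open>F\<close> has a quadratic expansion
  at every x, and its differentiability is a conclusion.

  The constants are budgets. The weight \<open>A\<close> lets the ascent contraction of the gap
  outweigh what the descent on \<open>F\<close> borrows from the gap; the price is the error of
  \<open>v\<close> at rate 9 Lf^2/\<mu>^2, which is the second summand in the bound on
  \<open>c1\<close>. The 9/4 in the bound on \<open>c2\<close> covers the error of \<open>w\<close>
  in the same way, and the common summand 2/(3 k^3) pays for the growth of the weight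
  \<gamma>/\<eta>.

  Expectations are nonnegative extended integrals. Integrability of the iterates then needs no
  separate induction, but nothing can be subtracted, so the telescoping keeps all terms as sums and
  Cauchy-Schwarz is applied as a family of linear bounds.\<close>

lemma lipschitz_gradient_upper_bound:
  fixes \<phi> :: "'a::real_inner \<Rightarrow> real"
  assumes der: "\<And>z. (\<phi> has_derivative (\<lambda>h. g z \<bullet> h)) (at z)"
    and lip: "\<And>z z'. norm (g z - g z') \<le> L * norm (z - z')"
  shows "\<phi> y \<le> \<phi> x + g x \<bullet> (y - x) + L / 2 * (norm (y - x))\<^sup>2"
proof -
  define d where "d = y - x"
  \<comment> \<open>On the segment this is \<open>\<phi>\<close> minus its quadratic model; the
    Lipschitz bound makes the derivative nonpositive, so the endpoints compare without integrating
    the gradient.\<close>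
  define \<psi> where "\<psi> s = \<phi> (x + s *\<^sub>R d) - s * (g x \<bullet> d) - L / 2 * s\<^sup>2 * (norm d)\<^sup>2" for s :: real
  have "\<psi> 1 \<le> \<psi> 0"
  proof (rule DERIV_nonpos_imp_nonincreasing[of 0 1 \<psi>])
    fix s :: real assume s: "0 \<le> s" "s \<le> 1"
    have "((\<lambda>s. x + s *\<^sub>R d) has_derivative (\<lambda>h. h *\<^sub>R d)) (at s)"
      by (auto intro!: derivative_eq_intros)
    then have "((\<lambda>s. \<phi> (x + s *\<^sub>R d)) has_derivative (\<lambda>h. g (x + s *\<^sub>R d) \<bullet> (h *\<^sub>R d))) (at s)"
      by (rule has_derivative_compose) (rule der)
    then have 1: "((\<lambda>s. \<phi> (x + s *\<^sub>R d)) has_field_derivative g (x + s *\<^sub>R d) \<bullet> d) (at s)"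
      by (simp add: has_field_derivative_def mult_commute_abs)
    have 2: "(\<psi> has_field_derivative (g (x + s *\<^sub>R d) \<bullet> d - g x \<bullet> d - L * s * (norm d)\<^sup>2)) (at s)"
      unfolding \<psi>_def by (rule derivative_eq_intros 1 refl)+ simp
    have "(g (x + s *\<^sub>R d) - g x) \<bullet> d \<le> norm (g (x + s *\<^sub>R d) - g x) * norm d"
      by (rule norm_cauchy_schwarz)
    also have "\<dots> \<le> (L * norm (s *\<^sub>R d)) * norm d"
      using lip[of "x + s *\<^sub>R d" x] by (intro mult_right_mono) auto
    finally have "g (x + s *\<^sub>R d) \<bullet> d - g x \<bullet> d - L * s * (norm d)\<^sup>2 \<le> 0"
      using s by (simp add: inner_diff_left power2_eq_square mult.assoc)
    then show "\<exists>D. (\<psi> has_field_derivative D) (at s) \<and> D \<le> 0" using 2 by blast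
  qed simp
  then show ?thesis by (simp add: \<psi>_def d_def)
qed

lemma lipschitz_gradient_lower_bound:
  fixes \<phi> :: "'a::real_inner \<Rightarrow> real"
  assumes der: "\<And>z. (\<phi> has_derivative (\<lambda>h. g z \<bullet> h)) (at z)"
    and lip: "\<And>z z'. norm (g z - g z') \<le> L * norm (z - z')"
  shows "\<phi> x + g x \<bullet> (y - x) - L / 2 * (norm (y - x))\<^sup>2 \<le> \<phi> y"
proof -
  have "((\<lambda>z. - \<phi> z) has_derivative (\<lambda>h. (- g z) \<bullet> h)) (at z)" for z
    using has_derivative_minus[OF der] by simp
  moreover have "norm (- g z - - g z') \<le> L * norm (z - z')" for z z'
    using lip[of z z'] by (simp add: norm_minus_commute)
  ultimately show ?thesis
    using lipschitz_gradient_upper_bound[of "\<lambda>z. - \<phi> z" "\<lambda>z. - g z" L y x] by simp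
qed

text \<open>Ekeland-type argument: where \<open>g > 0\<close>, the PL inequality forces the slope of \<open>\<surd>g\<close> to be at
  least \<open>\<surd>(\<mu>/2) > c\<close>, so a minimiser of \<open>\<surd>g + c\<parallel>\<cdot> - y\<parallel>\<close> must be a zero of \<open>g\<close>.\<close>

lemma PL_imp_near_zero:
  fixes g :: "'a::euclidean_space \<Rightarrow> real"
  assumes der: "\<And>z. (g has_derivative (\<lambda>h. G z \<bullet> h)) (at z)"
    and nonneg: "\<And>z. 0 \<le> g z"
    and PL: "\<And>z. 2 * \<mu> * g z \<le> (norm (G z))\<^sup>2"
    and c: "0 < c" "c < sqrt (\<mu> / 2)"
  shows "\<exists>z. g z = 0 \<and> c * norm (z - y) \<le> sqrt (g y)"
proof -
  define q where "q z = sqrt (g z) + c * norm (z - y)" for z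
  \<comment> \<open>Outside this ball the penalty alone exceeds \<open>q y = sqrt (g y)\<close>, so
    a minimiser over the compact ball is a global one.\<close>
  define K where "K = cball y (sqrt (g y) / c)"
  have contg: "continuous_on UNIV g"
    using der by (meson continuous_at_imp_continuous_on has_derivative_continuous)
  then have contq: "continuous_on K q"
    unfolding q_def by (intro continuous_intros) (auto intro: continuous_on_subset)
  have "y \<in> K" using nonneg c by (simp add: K_def)
  then obtain z where zK: "z \<in> K" and zmin: "\<And>u. u \<in> K \<Longrightarrow> q z \<le> q u"
    using continuous_attains_inf[of K q] contq by (auto simp: K_def)
  have glob: "q z \<le> q u" for u
  proof (cases "u \<in> K")
    case False
    then have "sqrt (g y) / c < norm (u - y)" by (simp add: K_def dist_norm norm_minus_commute)
    then have "sqrt (g y) < c * norm (u - y)" using c by (simp add: field_simps)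
    moreover have "q z \<le> sqrt (g y)" using zmin[OF \<open>y \<in> K\<close>] by (simp add: q_def)
    ultimately show ?thesis using nonneg[of u] by (simp add: q_def add_increasing)
  qed (rule zmin)
  have "g z = 0"
  proof (rule ccontr)
    assume "g z \<noteq> 0"
    then have gz: "g z > 0" using nonneg[of z] by simp
    have mu: "\<mu> > 0" using c by (metis less_trans real_sqrt_gt_0_iff zero_less_divide_iff zero_less_numeral not_numeral_less_zero)
    have nG: "sqrt (2 * \<mu> * g z) \<le> norm (G z)"
      using PL[of z] by (simp add: real_le_lsqrt)
    then have Gpos: "norm (G z) > 0"
      using gz mu by (smt (verit) mult_pos_pos real_sqrt_gt_zero)
    \<comment> \<open>The unit direction of steepest descent. The penalty grows at rate at most
      \<open>c\<close> along it, so \<open>r\<close> plus a constant dominates \<open>q\<close> on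
      the ray, with equality at 0; a negative slope of \<open>r\<close> contradicts
      minimality.\<close>
    define u where "u = (- 1 / norm (G z)) *\<^sub>R G z"
    have nu: "norm u = 1" using Gpos by (simp add: u_def)
    have Gu: "G z \<bullet> u = - norm (G z)"
      using Gpos by (simp add: u_def dot_square_norm power2_eq_square)
    define r where "r s = sqrt (g (z + s *\<^sub>R u)) + c * s" for s :: real
    have "((\<lambda>s. z + s *\<^sub>R u) has_derivative (\<lambda>h. h *\<^sub>R u)) (at 0)"
      by (auto intro!: derivative_eq_intros)
    then have "((\<lambda>s. g (z + s *\<^sub>R u)) has_derivative (\<lambda>h. G (z + 0 *\<^sub>R u) \<bullet> (h *\<^sub>R u))) (at 0)"
      by (rule has_derivative_compose) (rule der)
    then have "((\<lambda>s. g (z + s *\<^sub>R u)) has_derivative (*) (- norm (G z))) (at 0)"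
      by (rule has_derivative_eq_rhs) (simp add: Gu fun_eq_iff)
    then have 1: "((\<lambda>s. g (z + s *\<^sub>R u)) has_field_derivative - norm (G z)) (at 0)"
      by (simp add: has_field_derivative_def)
    have 3: "((\<lambda>s. sqrt (g (z + s *\<^sub>R u))) has_field_derivative
        - norm (G z) * (inverse (sqrt (g (z + 0 *\<^sub>R u))) / 2)) (at 0)"
      using DERIV_chain2[OF DERIV_real_sqrt 1] gz by (simp add: mult.commute)
    have 2: "(r has_field_derivative - norm (G z) * (inverse (sqrt (g z)) / 2) + c) (at 0)"
      unfolding r_def using DERIV_add[OF 3 DERIV_cmult_Id[of c]] by simp
    have "sqrt (\<mu> / 2) = sqrt (2 * \<mu> * g z) * (inverse (sqrt (g z)) / 2)"
    proof -
      have "sqrt (\<mu> / 2) = sqrt (2 * \<mu> / 4)" by simp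
      also have "\<dots> = sqrt (2 * \<mu>) / 2" by (simp only: real_sqrt_divide) simp
      finally show ?thesis using gz by (simp add: real_sqrt_mult field_simps)
    qed
    also have "\<dots> \<le> norm (G z) * (inverse (sqrt (g z)) / 2)"
      using nG gz by (intro mult_right_mono) auto
    finally have "- norm (G z) * (inverse (sqrt (g z)) / 2) + c < 0" using c by simp
    from DERIV_neg_dec_right[OF 2 this] obtain d where d: "d > 0"
      "\<And>h. 0 < h \<Longrightarrow> h < d \<Longrightarrow> r (0 + h) < r 0" by blast
    have "r (d / 2) < r 0" using d(2)[of "d / 2"] d(1) by simp
    moreover have "norm (z + (d / 2) *\<^sub>R u - y) \<le> norm (z - y) + d / 2"
      using norm_triangle_ineq[of "z - y" "(d / 2) *\<^sub>R u"] nu d(1) by (simp add: algebra_simps)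
    then have "c * norm (z + (d / 2) *\<^sub>R u - y) \<le> c * (norm (z - y) + d / 2)"
      using c by (intro mult_left_mono) auto
    then have "r 0 \<le> r (d / 2)"
      using glob[of "z + (d / 2) *\<^sub>R u"] by (simp add: r_def q_def algebra_simps)
    ultimately show False by simp
  qed
  moreover have "c * norm (z - y) \<le> sqrt (g y)"
    using glob[of y] \<open>g z = 0\<close> by (simp add: q_def)
  ultimately show ?thesis by blast
qed

text \<open>The Ekeland argument reaches only rates strictly below \<open>sqrt (\<mu> / 2)\<close>.
  The zero nearest to \<open>y\<close>, which exists because the zero set is closed, serves as one
  witness for all these rates, so the rate can pass to its limit.\<close>

lemma PL_imp_quadratic_growth:
  fixes g :: "'a::euclidean_space \<Rightarrow> real"
  assumes der: "\<And>z. (g has_derivative (\<lambda>h. G z \<bullet> h)) (at z)"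
    and nonneg: "\<And>z. 0 \<le> g z"
    and PL: "\<And>z. 2 * \<mu> * g z \<le> (norm (G z))\<^sup>2"
    and mu: "\<mu> > 0"
  shows "\<exists>z. g z = 0 \<and> \<mu> / 2 * (norm (z - y))\<^sup>2 \<le> g y"
proof -
  define Z where "Z = {z. g z = 0}"
  note near = PL_imp_near_zero[OF der nonneg PL]
  have r: "sqrt (\<mu> / 2) > 0" using mu by simp
  have contg: "continuous_on UNIV g"
    using der by (meson continuous_at_imp_continuous_on has_derivative_continuous)
  have "closed Z"
    unfolding Z_def using continuous_closed_preimage_constant[OF contg, of 0] by simp
  moreover have "Z \<noteq> {}"
    using near[of "sqrt (\<mu> / 2) / 2" y] r by (auto simp: Z_def)
  ultimately obtain z where z: "z \<in> Z" "\<And>u. u \<in> Z \<Longrightarrow> dist y z \<le> dist y u"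
    using distance_attains_inf[of Z y] by blast
  have "sqrt (\<mu> / 2) * norm (z - y) \<le> sqrt (g y)"
  proof (rule field_le_mult_one_interval)
    fix t :: real assume t: "0 < t" "t < 1"
    have "t * sqrt (\<mu> / 2) < sqrt (\<mu> / 2)" using r t by simp
    then obtain u where u: "g u = 0" "t * sqrt (\<mu> / 2) * norm (u - y) \<le> sqrt (g y)"
      using near[of "t * sqrt (\<mu> / 2)" y] t r by auto
    have "norm (z - y) \<le> norm (u - y)"
      using z(2)[of u] u(1) by (simp add: Z_def dist_norm norm_minus_commute)
    then have "t * sqrt (\<mu> / 2) * norm (z - y) \<le> t * sqrt (\<mu> / 2) * norm (u - y)"
      using t r by (intro mult_left_mono) auto
    then show "t * (sqrt (\<mu> / 2) * norm (z - y)) \<le> sqrt (g y)" using u by simp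
  qed
  then have "(sqrt (\<mu> / 2) * norm (z - y))\<^sup>2 \<le> (sqrt (g y))\<^sup>2"
    using r by (intro power_mono) auto
  then have "\<mu> / 2 * (norm (z - y))\<^sup>2 \<le> g y"
    using mu nonneg[of y] by (simp add: power_mult_distrib)
  then show ?thesis using z by (auto simp: Z_def)
qed

lemma has_derivative_of_quadratic_error:
  fixes \<phi> :: "'a::real_inner \<Rightarrow> real"
  assumes "\<And>z. \<bar>\<phi> z - \<phi> x - g \<bullet> (z - x)\<bar> \<le> C * (norm (z - x))\<^sup>2"
  shows "(\<phi> has_derivative (\<lambda>h. g \<bullet> h)) (at x)"
  unfolding has_derivative_at
proof
  show "bounded_linear (\<lambda>h. g \<bullet> h)" by (rule bounded_linear_inner_right)
  show "(\<lambda>h. norm (\<phi> (x + h) - \<phi> x - g \<bullet> h) / norm h) \<midarrow>0\<rightarrow> 0"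
  proof (rule tendsto_sandwich[of "\<lambda>_. 0" _ _ "\<lambda>h. C * norm h"])
    have "norm (\<phi> (x + h) - \<phi> x - g \<bullet> h) / norm h \<le> C * norm h" for h
      using assms[of "x + h"] by (cases "h = 0") (auto simp: field_simps power2_eq_square)
    then show "\<forall>\<^sub>F h in at 0. norm (\<phi> (x + h) - \<phi> x - g \<bullet> h) / norm h \<le> C * norm h" by simp
    show "((\<lambda>h. C * norm h) \<longlongrightarrow> 0) (at (0::'a))"
      by (rule tendsto_eq_intros refl | simp)+
  qed auto
qed

lemma grad_eq:
  assumes "(\<phi> has_derivative (\<lambda>h. g \<bullet> h)) (at x)"
  shows "grad \<phi> x = g"
  using frechet_derivative_at[OF assms, symmetric]
  by (simp add: grad_def euclidean_representation)

section \<open>The value function of a PL minimax problem\<close>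

text \<open>Only partial derivatives of \<open>f\<close> are given; the regularity of
  \<open>F\<close> is derived from them. In the theorem the Lipschitz bounds on \<open>Gx\<close>
  and \<open>Gy\<close> come from those on the samples by averaging.\<close>

locale pl_minimax =
  fixes f :: "'x::euclidean_space \<Rightarrow> 'y::euclidean_space \<Rightarrow> real"
    and Gx :: "'x \<Rightarrow> 'y \<Rightarrow> 'x" and Gy :: "'x \<Rightarrow> 'y \<Rightarrow> 'y" and \<mu> Lf :: real
  assumes df_x: "((\<lambda>x'. f x' y) has_derivative (\<lambda>h. Gx x y \<bullet> h)) (at x)"
    and df_y: "((\<lambda>y'. f x y') has_derivative (\<lambda>h. Gy x y \<bullet> h)) (at y)"
    and mu_pos: "\<mu> > 0"
    and argmax_ne: "\<exists>y. \<forall>y'. f x y' \<le> f x y"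
    and PL: "2 * \<mu> * (Fmax f x - f x y) \<le> (norm (Gy x y))\<^sup>2"
    and Lf_pos: "Lf > 0"
    and Gx_x: "norm (Gx x y - Gx x' y) \<le> Lf * norm (x - x')"
    and Gx_y: "norm (Gx x y - Gx x y') \<le> Lf * norm (y - y')"
    and Gy_x: "norm (Gy x y - Gy x' y) \<le> Lf * norm (x - x')"
    and Gy_y: "norm (Gy x y - Gy x y') \<le> Lf * norm (y - y')"
begin

abbreviation F where "F \<equiv> Fmax f"

lemma f_le_F: "f x y \<le> F x"
proof -
  obtain z where "\<And>y'. f x y' \<le> f x z" using argmax_ne by blast
  \<comment> \<open>A real supremum says something only about a bounded set; the maximiser supplies
    the bound.\<close>
  then have "bdd_above (range (f x))" by (intro bdd_aboveI2)
  then show ?thesis unfolding Fmax_def by (intro cSUP_upper) auto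
qed

lemma F_attained: "\<exists>y. f x y = F x"
proof -
  obtain y where y: "\<And>y'. f x y' \<le> f x y" using argmax_ne by blast
  then have "F x \<le> f x y" unfolding Fmax_def by (intro cSUP_least) auto
  then show ?thesis using f_le_F[of x y] by (intro exI[of _ y]) simp
qed

lemma Gy_argmax:
  assumes "f x y = F x" shows "Gy x y = 0"
proof -
  have "(\<lambda>h. Gy x y \<bullet> h) = (\<lambda>h. 0)"
    by (rule differential_zero_maxmin[OF _ open_UNIV df_y]) (use f_le_F assms in auto)
  then show ?thesis by (metis inner_eq_zero_iff)
qed

lemma near_argmax: "\<exists>z. f x z = F x \<and> \<mu> / 2 * (norm (z - y))\<^sup>2 \<le> F x - f x y"
proof -
  have "\<exists>z. F x - f x z = 0 \<and> \<mu> / 2 * (norm (z - y))\<^sup>2 \<le> F x - f x y"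
  proof (rule PL_imp_quadratic_growth[where G = "\<lambda>y. - Gy x y"])
    show "((\<lambda>z. F x - f x z) has_derivative (\<lambda>h. - Gy x z \<bullet> h)) (at z)" for z
      using has_derivative_diff[OF has_derivative_const df_y] by simp
  qed (use f_le_F PL mu_pos in auto)
  then show ?thesis by auto
qed

text \<open>Quadratic growth and PL at the new point \<open>x'\<close> combine to \<mu> * norm (z -
  y) \<le> norm (Gy x' y). As \<open>Gy x y = 0\<close>, the gradient on the right is purely a
  change in \<open>x\<close>. The witness depends on \<open>y\<close> because maximisers need not be
  unique.\<close>

lemma argmax_lipschitz:
  assumes "f x y = F x"
  shows "\<exists>z. f x' z = F x' \<and> norm (z - y) \<le> Lf / \<mu> * norm (x' - x)"
proof -
  obtain z where z: "f x' z = F x'" "\<mu> / 2 * (norm (z - y))\<^sup>2 \<le> F x' - f x' y"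
    using near_argmax by blast
  have "(\<mu> * norm (z - y))\<^sup>2 = 2 * \<mu> * (\<mu> / 2 * (norm (z - y))\<^sup>2)"
    by (simp add: power2_eq_square)
  also have "\<dots> \<le> 2 * \<mu> * (F x' - f x' y)"
    using z(2) mu_pos by (intro mult_left_mono) auto
  also have "\<dots> \<le> (norm (Gy x' y))\<^sup>2" by (rule PL)
  finally have "\<mu> * norm (z - y) \<le> norm (Gy x' y)"
    by (rule power2_le_imp_le) simp
  also have "\<dots> \<le> Lf * norm (x' - x)"
    using Gy_x[of x' y x] Gy_argmax[OF assms] by simp
  finally show ?thesis using z(1) mu_pos by (auto simp: field_simps)
qed

text \<open>A Danskin expansion without uniqueness. From below, \<open>y\<close> remains a
  competitor at \<open>x'\<close>. From above, a maximiser \<open>z\<close> at \<open>x'\<close>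
  close to \<open>y\<close> is a competitor at \<open>x\<close>; exchanging \<open>Gx x z\<close>
  for \<open>Gx x y\<close> costs Lf * norm (z - y), which is the origin of the term
  \<open>Lf\<^sup>2 / \<mu>\<close>.\<close>

lemma F_quadratic_error:
  assumes y: "f x y = F x"
  shows "\<bar>F x' - F x - Gx x y \<bullet> (x' - x)\<bar> \<le> (Lf / 2 + Lf\<^sup>2 / \<mu>) * (norm (x' - x))\<^sup>2"
proof -
  obtain z where z: "f x' z = F x'" "norm (z - y) \<le> Lf / \<mu> * norm (x' - x)"
    using argmax_lipschitz[OF y] by blast
  have "f x' z \<le> f x z + Gx x z \<bullet> (x' - x) + Lf / 2 * (norm (x' - x))\<^sup>2"
    by (rule lipschitz_gradient_upper_bound[where \<phi> = "\<lambda>x. f x z" and g = "\<lambda>x. Gx x z", OF df_x Gx_x])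
  moreover have "(Gx x z - Gx x y) \<bullet> (x' - x) \<le> Lf\<^sup>2 / \<mu> * (norm (x' - x))\<^sup>2"
  proof -
    have "(Gx x z - Gx x y) \<bullet> (x' - x) \<le> norm (Gx x z - Gx x y) * norm (x' - x)"
      by (rule norm_cauchy_schwarz)
    also have "\<dots> \<le> (Lf * (Lf / \<mu> * norm (x' - x))) * norm (x' - x)"
      by (intro mult_right_mono order_trans[OF Gx_y] mult_left_mono z(2)) (use Lf_pos in auto)
    finally show ?thesis by (simp add: power2_eq_square mult.assoc)
  qed
  ultimately have up: "F x' - F x - Gx x y \<bullet> (x' - x) \<le> (Lf / 2 + Lf\<^sup>2 / \<mu>) * (norm (x' - x))\<^sup>2"
    using z(1) f_le_F[of x z] by (simp add: inner_diff_left algebra_simps)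
  have "f x y + Gx x y \<bullet> (x' - x) - Lf / 2 * (norm (x' - x))\<^sup>2 \<le> f x' y"
    by (rule lipschitz_gradient_lower_bound[where \<phi> = "\<lambda>x. f x y" and g = "\<lambda>x. Gx x y", OF df_x Gx_x])
  moreover have "0 \<le> Lf\<^sup>2 / \<mu> * (norm (x' - x))\<^sup>2" using mu_pos by simp
  ultimately have "- (Lf / 2 + Lf\<^sup>2 / \<mu>) * (norm (x' - x))\<^sup>2 \<le> F x' - F x - Gx x y \<bullet> (x' - x)"
    using y f_le_F[of x' y] by (simp add: algebra_simps)
  then show ?thesis using up by (simp add: abs_le_iff algebra_simps)
qed

lemma F_has_derivative: "f x y = F x \<Longrightarrow> (F has_derivative (\<lambda>h. Gx x y \<bullet> h)) (at x)"
  by (rule has_derivative_of_quadratic_error) (rule F_quadratic_error)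

lemma F_differentiable: "F differentiable (at x)"
  using F_has_derivative F_attained[of x] by (meson differentiable_def)

lemma grad_F: "f x y = F x \<Longrightarrow> grad F x = Gx x y"
  by (rule grad_eq) (rule F_has_derivative)

lemma F_upper_bound: "F x' \<le> F x + grad F x \<bullet> (x' - x) + (Lf / 2 + Lf\<^sup>2 / \<mu>) * (norm (x' - x))\<^sup>2"
  using F_attained[of x] F_quadratic_error grad_F by (smt (verit))

text \<open>Every maximiser represents the gradient of \<open>F\<close>, so the one near
  \<open>y\<close> may be used, and its distance is controlled by the gap. The middle term of the
  metric is the root of this bound.\<close>

lemma grad_F_gap: "(norm (grad F x - Gx x y))\<^sup>2 \<le> 2 * Lf\<^sup>2 / \<mu> * (F x - f x y)"
proof -
  obtain z where z: "f x z = F x" "\<mu> / 2 * (norm (z - y))\<^sup>2 \<le> F x - f x y"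
    using near_argmax by blast
  have "(norm (grad F x - Gx x y))\<^sup>2 \<le> (Lf * norm (z - y))\<^sup>2"
    using Gx_y[of x z y] grad_F[OF z(1)] by (intro power_mono) auto
  also have "\<dots> = 2 * Lf\<^sup>2 / \<mu> * (\<mu> / 2 * (norm (z - y))\<^sup>2)"
    using mu_pos by (simp add: power_mult_distrib)
  also have "\<dots> \<le> 2 * Lf\<^sup>2 / \<mu> * (F x - f x y)"
    using z(2) mu_pos by (intro mult_left_mono) auto
  finally show ?thesis .
qed

end

section \<open>One deterministic step\<close>

text \<open>The left side is the factor of the squared norm of \<open>w\<close>, divided by
  \<gamma>\<eta>, once the bounds for \<open>F\<close>, for the gap and for the drift of the
  momentum errors are added. In the scale-free variables of the proof the five partial bounds sum to
  about 0.2445, so the cruder smoothness constant just fits below 1/4.\<close>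

lemma step_coefficient_bound:
  fixes Lf \<mu> \<gamma> lam \<eta> :: real
  assumes pos: "Lf > 0" "\<mu> > 0" "\<gamma> > 0" "lam > 0" "\<eta> > 0"
    and eta: "\<eta> \<le> 1" "lam * \<eta> * Lf \<le> 1 / 2"
    and lam: "(lam * \<mu>)\<^sup>2 \<le> 9 / 32"
    and gam: "\<gamma> * (Lf * (1 + (Lf / \<mu>) / 2)) \<le> lam * \<mu> / 16"
  shows "(Lf / 2 + Lf\<^sup>2 / \<mu>) * \<gamma> * \<eta>
      + 9 * Lf\<^sup>2 * \<gamma>\<^sup>2 / (lam * \<mu>\<^sup>2) * (Lf\<^sup>2 / (lam * \<mu>\<^sup>2) + (Lf + Lf\<^sup>2 / \<mu>) * \<eta> + lam * \<eta>\<^sup>2 * Lf\<^sup>2)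
      + 8 * \<gamma>\<^sup>2 * Lf\<^sup>2 \<le> 1 / 4"
proof -
  define \<kappa> where "\<kappa> = Lf / \<mu>"
  define a where "a = lam * \<mu>"
  define b where "b = lam * \<eta> * Lf"
  define g where "g = \<gamma> * Lf / a"
  have nn: "\<kappa> > 0" "a > 0" "b > 0" "g > 0"
    using pos by (auto simp: \<kappa>_def a_def b_def g_def)
  have p: "g * (1 + \<kappa> / 2) \<le> 1 / 16"
    using gam nn(2) by (simp add: g_def \<kappa>_def a_def field_simps)
  have b: "b \<le> 1 / 2" using eta by (simp add: b_def)
  have a2: "a\<^sup>2 \<le> 9 / 32" using lam by (simp add: a_def)
  \<comment> \<open>A rational upper bound for the square root of 9/32.\<close>
  have a: "a \<le> 11 / 20"
    by (rule power2_le_imp_le) (use a2 in \<open>auto simp: power2_eq_square\<close>)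
  have g: "g \<le> 1 / 16"
    using p mult_pos_pos[OF nn(4) nn(1)] by (simp add: algebra_simps)
  have kg: "\<kappa> * g \<le> 1 / 8" using p nn by (simp add: algebra_simps)
  have p2: "(g * (1 + \<kappa> / 2))\<^sup>2 \<le> 1 / 256"
    using power_mono[OF p, of 2] nn by (simp add: power2_eq_square)
  have g2: "g\<^sup>2 \<le> 1 / 256" using power_mono[OF g, of 2] nn by (simp add: power2_eq_square)
  have t0: "(Lf / 2 + Lf\<^sup>2 / \<mu>) * \<gamma> * \<eta> \<le> 11 / 160"
  proof -
    have "(Lf / 2 + Lf\<^sup>2 / \<mu>) * \<gamma> * \<eta> = (g * (1 / 2 + \<kappa>)) * a * \<eta>"
      using pos nn by (simp add: g_def \<kappa>_def field_simps power2_eq_square)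
    also have "\<dots> \<le> (1 / 8) * (11 / 20) * 1"
    proof (intro mult_mono)
      show "g * (1 / 2 + \<kappa>) \<le> 1 / 8" using p nn by (simp add: algebra_simps)
    qed (use nn a eta pos in auto)
    finally show ?thesis by simp
  qed
  have t1: "9 * (\<kappa> * g)\<^sup>2 \<le> 9 / 64"
    using power_mono[OF kg, of 2] nn by (simp add: power2_eq_square mult.assoc mult.left_commute)
  have t2: "9 * (g\<^sup>2 * (1 + \<kappa>)) * b \<le> 9 / 512"
  proof -
    have "g\<^sup>2 * (1 + \<kappa>) \<le> (g * (1 + \<kappa> / 2))\<^sup>2"
      using zero_le_power2[of "\<kappa> * g"] by (simp add: power2_eq_square algebra_simps)
    with p2 have "g\<^sup>2 * (1 + \<kappa>) \<le> 1 / 256" by simp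
    then have "(g\<^sup>2 * (1 + \<kappa>)) * b \<le> (1 / 256) * (1 / 2)"
      using b nn by (intro mult_mono) auto
    then show ?thesis by (simp add: ac_simps)
  qed
  have t3: "9 * (g\<^sup>2 * b\<^sup>2) \<le> 9 / 1024"
    using mult_mono[OF g2 power_mono[OF b, of 2]] nn by (simp add: power2_eq_square ac_simps)
  have t4: "8 * (g\<^sup>2 * a\<^sup>2) \<le> 9 / 1024"
    using mult_mono[OF g2 a2] by simp
  have eq: "9 * Lf\<^sup>2 * \<gamma>\<^sup>2 / (lam * \<mu>\<^sup>2) * (Lf\<^sup>2 / (lam * \<mu>\<^sup>2) + (Lf + Lf\<^sup>2 / \<mu>) * \<eta> + lam * \<eta>\<^sup>2 * Lf\<^sup>2)
      = 9 * (\<kappa> * g)\<^sup>2 + 9 * (g\<^sup>2 * (1 + \<kappa>)) * b + 9 * (g\<^sup>2 * b\<^sup>2)"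
    using pos by (simp add: g_def \<kappa>_def a_def b_def field_simps power2_eq_square)
  have eq4: "8 * \<gamma>\<^sup>2 * Lf\<^sup>2 = 8 * (g\<^sup>2 * a\<^sup>2)"
    using nn by (simp add: g_def power_divide power_mult_distrib)
  show ?thesis unfolding eq eq4 using t0 t1 t2 t3 t4 by linarith
qed

context pl_minimax
begin

text \<open>Polarisation turns the inner product of \<open>grad F x\<close> and \<open>w\<close>
  into squares, of which that of \<open>grad F x\<close> is dropped. The distance between the two is
  split at \<open>Gx x y\<close> into a gap part and the estimator error.\<close>

lemma F_step:
  assumes "\<gamma> > 0" "\<eta> > 0"
  shows "F (x - (\<gamma> * \<eta>) *\<^sub>R w) \<le> F x + \<gamma> * \<eta> * (2 * Lf\<^sup>2 / \<mu> * (F x - f x y) + (norm (Gx x y - w))\<^sup>2)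
    - \<gamma> * \<eta> / 2 * (norm w)\<^sup>2 + (Lf / 2 + Lf\<^sup>2 / \<mu>) * (\<gamma> * \<eta>)\<^sup>2 * (norm w)\<^sup>2"
proof -
  let ?g = "grad F x"
  define Q where "Q = 2 * Lf\<^sup>2 / \<mu> * (F x - f x y)"
  define C where "C = Lf / 2 + Lf\<^sup>2 / \<mu>"
  have "norm (?g - w) \<le> norm (?g - Gx x y) + norm (Gx x y - w)"
    using norm_triangle_ineq[of "?g - Gx x y" "Gx x y - w"] by simp
  then have "(norm (?g - w))\<^sup>2 \<le> (norm (?g - Gx x y) + norm (Gx x y - w))\<^sup>2"
    by (intro power_mono) auto
  also have "\<dots> \<le> 2 * (norm (?g - Gx x y))\<^sup>2 + 2 * (norm (Gx x y - w))\<^sup>2"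
    using zero_le_power2[of "norm (?g - Gx x y) - norm (Gx x y - w)"]
    by (simp add: power2_eq_square algebra_simps)
  also have "\<dots> \<le> 2 * Q + 2 * (norm (Gx x y - w))\<^sup>2"
    using grad_F_gap[of x y] by (simp add: Q_def)
  finally have 1: "(norm (?g - w))\<^sup>2 \<le> \<dots>" .
  have "- (?g \<bullet> w) = ((norm (?g - w))\<^sup>2 - (norm ?g)\<^sup>2 - (norm w)\<^sup>2) / 2"
    by (simp add: power2_norm_eq_inner inner_diff_left inner_diff_right inner_commute)
  also have "\<dots> \<le> Q + (norm (Gx x y - w))\<^sup>2 - (norm w)\<^sup>2 / 2"
  proof -
    have "(a - b - c) / 2 \<le> p + q - c / 2" if "a \<le> 2 * p + 2 * q" "0 \<le> b" for a b c p q :: real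
      using that by (simp add: field_simps)
    from this[OF 1 zero_le_power2] show ?thesis .
  qed
  finally have "(\<gamma> * \<eta>) * - (?g \<bullet> w) \<le> (\<gamma> * \<eta>) * \<dots>"
    using assms by (intro mult_left_mono) auto
  moreover have "F (x - (\<gamma> * \<eta>) *\<^sub>R w) \<le> F x + (\<gamma> * \<eta>) * - (?g \<bullet> w)
      + C * ((\<gamma> * \<eta>)\<^sup>2 * (norm w)\<^sup>2)"
    using F_upper_bound[of "x - (\<gamma> * \<eta>) *\<^sub>R w" x] by (simp add: power_mult_distrib C_def)
  ultimately show ?thesis
    unfolding Q_def[symmetric] C_def[symmetric] by (simp add: algebra_simps)
qed

text \<open>To first order the gap changes by the inner product of \<open>Gx x y - grad F x\<close>
  with \<open>w\<close>, and that difference is itself bounded by the root of the gap.\<close>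

lemma gap_x_step:
  assumes "\<gamma> > 0" "\<eta> > 0" "lam > 0"
  shows "F (x - (\<gamma> * \<eta>) *\<^sub>R w) - f (x - (\<gamma> * \<eta>) *\<^sub>R w) y \<le> (1 + lam * \<eta> * \<mu> / 2) * (F x - f x y)
    + (\<gamma>\<^sup>2 * \<eta> * Lf\<^sup>2 / (lam * \<mu>\<^sup>2) + (Lf + Lf\<^sup>2 / \<mu>) * (\<gamma> * \<eta>)\<^sup>2) * (norm w)\<^sup>2"
proof -
  let ?g = "grad F x" and ?x = "x - (\<gamma> * \<eta>) *\<^sub>R w"
  define p where "p = norm (Gx x y - ?g)"
  define q where "q = norm w"
  \<comment> \<open>Weights for Young's inequality: 4ab is the square of \<gamma>\<eta>, and
    \<open>a\<close> is tuned so that the gap grows by the fraction lam \<eta> \<mu> / 2, half of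
    what the ascent step contracts.\<close>
  define a where "a = lam * \<eta> * \<mu>\<^sup>2 / (4 * Lf\<^sup>2)"
  define b where "b = \<gamma>\<^sup>2 * \<eta> * Lf\<^sup>2 / (lam * \<mu>\<^sup>2)"
  have ab: "a > 0" "b > 0" using assms mu_pos Lf_pos by (auto simp: a_def b_def)
  have "4 * (a * b) = (\<gamma> * \<eta>)\<^sup>2"
    using assms mu_pos Lf_pos by (simp add: a_def b_def field_simps power2_eq_square)
  then have "(2 * (sqrt a * sqrt b))\<^sup>2 = (\<gamma> * \<eta>)\<^sup>2"
    using ab by (simp add: power_mult_distrib)
  then have sab: "2 * (sqrt a * sqrt b) = \<gamma> * \<eta>"
    by (rule power2_eq_imp_eq) (use assms ab in auto)
  have "0 \<le> (sqrt a * p - sqrt b * q)\<^sup>2" by simp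
  also have "\<dots> = (sqrt a)\<^sup>2 * p\<^sup>2 + (sqrt b)\<^sup>2 * q\<^sup>2 - 2 * (sqrt a * sqrt b) * (p * q)"
    by (simp add: power2_eq_square algebra_simps)
  finally have pq: "\<gamma> * \<eta> * (p * q) \<le> a * p\<^sup>2 + b * q\<^sup>2" using ab by (simp add: sab)
  have "p\<^sup>2 \<le> 2 * Lf\<^sup>2 / \<mu> * (F x - f x y)"
    using grad_F_gap[of x y] by (simp add: p_def norm_minus_commute)
  then have "a * p\<^sup>2 \<le> a * (2 * Lf\<^sup>2 / \<mu> * (F x - f x y))"
    using ab by (intro mult_left_mono) auto
  also have "\<dots> = lam * \<eta> * \<mu> / 2 * (F x - f x y)"
    using mu_pos Lf_pos by (simp add: a_def field_simps power2_eq_square)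
  finally have ap: "a * p\<^sup>2 \<le> \<dots>" .
  have "(\<gamma> * \<eta>) * ((Gx x y - ?g) \<bullet> w) \<le> (\<gamma> * \<eta>) * (p * q)"
    unfolding p_def q_def using assms by (intro mult_left_mono norm_cauchy_schwarz) auto
  moreover have "F ?x \<le> F x + (\<gamma> * \<eta>) * - (?g \<bullet> w) + (Lf / 2 + Lf\<^sup>2 / \<mu>) * ((\<gamma> * \<eta>)\<^sup>2 * q\<^sup>2)"
    using F_upper_bound[of ?x x] by (simp add: power_mult_distrib q_def)
  moreover have "f x y + (\<gamma> * \<eta>) * - (Gx x y \<bullet> w) - Lf / 2 * ((\<gamma> * \<eta>)\<^sup>2 * q\<^sup>2) \<le> f ?x y"
    using lipschitz_gradient_lower_bound[where \<phi> = "\<lambda>x. f x y" and g = "\<lambda>x. Gx x y", OF df_x Gx_x, of x ?x]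
    by (simp add: power_mult_distrib q_def)
  ultimately have "F ?x - f ?x y \<le> F x - f x y + (a * p\<^sup>2 + b * q\<^sup>2) + (Lf + Lf\<^sup>2 / \<mu>) * ((\<gamma> * \<eta>)\<^sup>2 * q\<^sup>2)"
    using pq by (simp add: inner_diff_left algebra_simps)
  also have "\<dots> \<le> F x - f x y + (lam * \<eta> * \<mu> / 2 * (F x - f x y) + b * q\<^sup>2)
      + (Lf + Lf\<^sup>2 / \<mu>) * ((\<gamma> * \<eta>)\<^sup>2 * q\<^sup>2)"
    using ap by simp
  finally show ?thesis by (simp add: b_def q_def algebra_simps)
qed

text \<open>The ascent is measured at the new \<open>x'\<close> while \<open>v\<close> estimates
  \<open>Gy x y\<close>; the mismatch costs Lf * norm (x' - x). Polarisation yields half of the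
  square of \<open>norm v\<close>, and the curvature term takes half of that because lam \<eta> Lf
  \<le> 1/2. PL converts the squared gradient into contraction.\<close>

lemma gap_y_step:
  assumes "lam > 0" "\<eta> > 0" and eta: "lam * \<eta> * Lf \<le> 1 / 2"
  shows "F x' - f x' (y + (lam * \<eta>) *\<^sub>R v) \<le> (1 - lam * \<eta> * \<mu>) * (F x' - f x' y)
    + lam * \<eta> * (Lf\<^sup>2 * (norm (x' - x))\<^sup>2 + (norm (Gy x y - v))\<^sup>2) - lam * \<eta> / 4 * (norm v)\<^sup>2"
proof -
  let ?g = "Gy x' y" and ?l = "lam * \<eta>"
  have l: "?l > 0" using assms by simp
  have "norm (?g - v) \<le> norm (?g - Gy x y) + norm (Gy x y - v)"
    using norm_triangle_ineq[of "?g - Gy x y" "Gy x y - v"] by simp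
  also have "\<dots> \<le> Lf * norm (x' - x) + norm (Gy x y - v)" using Gy_x by simp
  finally have "(norm (?g - v))\<^sup>2 \<le> (Lf * norm (x' - x) + norm (Gy x y - v))\<^sup>2"
    by (intro power_mono) auto
  also have "\<dots> \<le> 2 * (Lf * norm (x' - x))\<^sup>2 + 2 * (norm (Gy x y - v))\<^sup>2"
    using zero_le_power2[of "Lf * norm (x' - x) - norm (Gy x y - v)"]
    by (simp add: power2_eq_square algebra_simps)
  finally have 1: "(norm (?g - v))\<^sup>2 \<le> 2 * (Lf\<^sup>2 * (norm (x' - x))\<^sup>2) + 2 * (norm (Gy x y - v))\<^sup>2"
    by (simp add: power_mult_distrib)
  have "?g \<bullet> v = ((norm ?g)\<^sup>2 + (norm v)\<^sup>2 - (norm (?g - v))\<^sup>2) / 2"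
    by (simp add: power2_norm_eq_inner inner_diff_left inner_diff_right inner_commute)
  also have "\<dots> \<ge> \<mu> * (F x' - f x' y) + (norm v)\<^sup>2 / 2
      - (Lf\<^sup>2 * (norm (x' - x))\<^sup>2 + (norm (Gy x y - v))\<^sup>2)"
  proof -
    have "p + c / 2 - (q + r) \<le> (b + c - a) / 2" if "a \<le> 2 * q + 2 * r" "2 * p \<le> b" for a b c p q r :: real
      using that by (simp add: field_simps)
    from this[OF 1 PL[of x' y, unfolded mult.assoc]] show ?thesis .
  qed
  finally have 2: "?l * (\<mu> * (F x' - f x' y) + (norm v)\<^sup>2 / 2
      - (Lf\<^sup>2 * (norm (x' - x))\<^sup>2 + (norm (Gy x y - v))\<^sup>2)) \<le> ?l * (?g \<bullet> v)"
    using l by (intro mult_left_mono) auto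
  have 3: "f x' y + ?l * (?g \<bullet> v) - Lf / 2 * (?l\<^sup>2 * (norm v)\<^sup>2) \<le> f x' (y + ?l *\<^sub>R v)"
    using lipschitz_gradient_lower_bound[where \<phi> = "f x'" and g = "Gy x'", OF df_y Gy_y, of y "y + ?l *\<^sub>R v"]
    by (simp add: power_mult_distrib)
  have "Lf / 2 * (?l\<^sup>2 * (norm v)\<^sup>2) = (?l * Lf) * (?l / 2 * (norm v)\<^sup>2)"
    by (simp add: power2_eq_square)
  also have "\<dots> \<le> 1 / 2 * (?l / 2 * (norm v)\<^sup>2)"
    using eta l by (intro mult_right_mono) auto
  finally have 4: "Lf / 2 * (?l\<^sup>2 * (norm v)\<^sup>2) \<le> ?l / 4 * (norm v)\<^sup>2" by simp
  show ?thesis using 2 3 4 by (simp add: algebra_simps)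
qed

text \<open>The term with factor 8 reserves room for the drift of the momentum errors: it is
  \<gamma>/\<eta> times the displacement term in their expected bound. In units of \<gamma>\<eta>
  Lf^2/\<mu>, contraction releases 9/2 of the gap, while the descent on \<open>F\<close> spends 2
  and the dissipation 1/2.\<close>

lemma lyapunov_step:
  assumes pos: "\<gamma> > 0" "lam > 0" "\<eta> > 0"
    and eta: "\<eta> \<le> 1" "lam * \<eta> * Lf \<le> 1 / 2"
    and lam: "(lam * \<mu>)\<^sup>2 \<le> 9 / 32"
    and gam: "\<gamma> * (Lf * (1 + (Lf / \<mu>) / 2)) \<le> lam * \<mu> / 16"
    and x': "x' = x - (\<gamma> * \<eta>) *\<^sub>R w" and y': "y' = y + (lam * \<eta>) *\<^sub>R v"
    and A: "A = 9 * \<gamma> * Lf\<^sup>2 / (lam * \<mu>\<^sup>2)"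
  shows "F x' + A * (F x' - f x' y') + 8 * \<gamma> * \<eta> * Lf\<^sup>2 * (\<gamma>\<^sup>2 * (norm w)\<^sup>2 + lam\<^sup>2 * (norm v)\<^sup>2)
      + \<gamma> * \<eta> / 4 * ((norm w)\<^sup>2 + 2 * Lf\<^sup>2 / \<mu> * (F x - f x y))
    \<le> F x + A * (F x - f x y) + \<gamma> * \<eta> * (norm (Gx x y - w))\<^sup>2
      + 9 * Lf\<^sup>2 / \<mu>\<^sup>2 * (\<gamma> * \<eta>) * (norm (Gy x y - v))\<^sup>2"
proof -
  define \<Delta> where "\<Delta> = F x - f x y"
  define W where "W = (norm w)\<^sup>2"
  define V where "V = (norm v)\<^sup>2"
  define ex where "ex = (norm (Gx x y - w))\<^sup>2"
  define ey where "ey = (norm (Gy x y - v))\<^sup>2"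
  define C where "C = Lf / 2 + Lf\<^sup>2 / \<mu>"
  define K where "K = \<gamma>\<^sup>2 * \<eta> * Lf\<^sup>2 / (lam * \<mu>\<^sup>2) + (Lf + Lf\<^sup>2 / \<mu>) * (\<gamma> * \<eta>)\<^sup>2"
  define \<theta> where "\<theta> = lam * \<eta> * \<mu>"
  note pos = pos mu_pos Lf_pos
  have nn: "\<Delta> \<ge> 0" "W \<ge> 0" "V \<ge> 0" "\<theta> > 0"
    using f_le_F[of x y] pos by (auto simp: \<Delta>_def W_def V_def \<theta>_def)
  have nnK: "K \<ge> 0" unfolding K_def
    by (intro add_nonneg_nonneg mult_nonneg_nonneg divide_nonneg_nonneg) (use pos in auto)
  have nnA: "A > 0" unfolding A using pos by (intro divide_pos_pos mult_pos_pos) auto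
  note nn = nn nnK nnA
  have "(lam * \<mu>)\<^sup>2 \<le> 1\<^sup>2" using lam by simp
  then have "lam * \<mu> \<le> 1" by (rule power2_le_imp_le) simp
  then have "(lam * \<mu>) * \<eta> \<le> 1 * 1" using eta pos by (intro mult_mono) auto
  then have \<theta>1: "\<theta> \<le> 1" by (simp add: \<theta>_def ac_simps)
  have Fs: "F x' \<le> F x + \<gamma> * \<eta> * (2 * Lf\<^sup>2 / \<mu> * \<Delta> + ex) - \<gamma> * \<eta> / 2 * W + C * (\<gamma> * \<eta>)\<^sup>2 * W"
    unfolding x' \<Delta>_def ex_def W_def C_def by (rule F_step) (use pos in auto)
  have M: "F x' - f x' y \<le> (1 + \<theta> / 2) * \<Delta> + K * W"
    unfolding x' \<Delta>_def W_def K_def \<theta>_def by (rule gap_x_step) (use pos in auto)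
  have "(norm (x' - x))\<^sup>2 = (\<gamma> * \<eta>)\<^sup>2 * W" by (simp add: x' W_def power_mult_distrib)
  then have "F x' - f x' y' \<le> (1 - \<theta>) * (F x' - f x' y)
      + lam * \<eta> * (Lf\<^sup>2 * ((\<gamma> * \<eta>)\<^sup>2 * W) + ey) - lam * \<eta> / 4 * V"
    using gap_y_step[OF pos(2,3) eta(2), of x' y v x] by (simp add: y' \<theta>_def ey_def V_def)
  also have "(1 - \<theta>) * (F x' - f x' y) \<le> (1 - \<theta>) * ((1 + \<theta> / 2) * \<Delta> + K * W)"
    using M \<theta>1 by (intro mult_left_mono) auto
  \<comment> \<open>The growth 1 + \<theta>/2 caused by moving \<open>x\<close> meets the
    contraction 1 - \<theta> of the ascent; the product is at most 1 - \<theta>/2.\<close>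
  also have "\<dots> = (1 - \<theta> / 2) * \<Delta> + K * W - (\<theta>\<^sup>2 / 2 * \<Delta> + \<theta> * (K * W))"
    by (simp add: field_simps power2_eq_square)
  also have "\<dots> \<le> (1 - \<theta> / 2) * \<Delta> + K * W"
  proof -
    have "0 \<le> \<theta>\<^sup>2 / 2 * \<Delta> + \<theta> * (K * W)"
      using nn by (intro add_nonneg_nonneg mult_nonneg_nonneg) auto
    then show ?thesis by simp
  qed
  finally have "F x' - f x' y' \<le> (1 - \<theta> / 2) * \<Delta> + K * W
      + lam * \<eta> * (Lf\<^sup>2 * ((\<gamma> * \<eta>)\<^sup>2 * W) + ey) - lam * \<eta> / 4 * V" by simp
  then have "A * (F x' - f x' y') \<le> A * ((1 - \<theta> / 2) * \<Delta> + K * W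
      + lam * \<eta> * (Lf\<^sup>2 * ((\<gamma> * \<eta>)\<^sup>2 * W) + ey) - lam * \<eta> / 4 * V)"
    using nn by (intro mult_left_mono) auto
  also have "\<dots> = A * \<Delta> - A * \<theta> / 2 * \<Delta> + A * (K + lam * \<eta> * (Lf\<^sup>2 * (\<gamma> * \<eta>)\<^sup>2)) * W
      + A * lam * \<eta> * ey - A * lam * \<eta> / 4 * V"
    by (simp add: algebra_simps)
  also have "A * \<theta> / 2 = 9 / 2 * (\<gamma> * \<eta> * Lf\<^sup>2 / \<mu>)"
    using pos by (simp add: A \<theta>_def field_simps power2_eq_square)
  also have "A * lam * \<eta> = 9 * Lf\<^sup>2 / \<mu>\<^sup>2 * (\<gamma> * \<eta>)"
    using pos by (simp add: A)
  finally have As: "A * (F x' - f x' y') \<le> A * \<Delta> - 9 / 2 * (\<gamma> * \<eta> * Lf\<^sup>2 / \<mu>) * \<Delta>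
      + A * (K + lam * \<eta> * (Lf\<^sup>2 * (\<gamma> * \<eta>)\<^sup>2)) * W + 9 * Lf\<^sup>2 / \<mu>\<^sup>2 * (\<gamma> * \<eta>) * ey
      - 9 * Lf\<^sup>2 / \<mu>\<^sup>2 * (\<gamma> * \<eta>) / 4 * V" .
  have Dc: "\<gamma> * \<eta> * (2 * Lf\<^sup>2 / \<mu> * \<Delta>) + \<gamma> * \<eta> / 4 * (2 * Lf\<^sup>2 / \<mu> * \<Delta>) \<le> 9 / 2 * (\<gamma> * \<eta> * Lf\<^sup>2 / \<mu>) * \<Delta>"
  proof -
    have "0 \<le> \<gamma> * \<eta> * Lf\<^sup>2 / \<mu> * \<Delta>" using nn pos by simp
    then show ?thesis by (simp add: algebra_simps)
  qed
  \<comment> \<open>Without its common factors this is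
    \<open>(lam * \<mu>)\<^sup>2 \<le> 9 / 32\<close>, the square of the bound
    \<open>3 / (4 * sqrt 2 * \<mu>)\<close> imposed on \<open>lam\<close>.\<close>
  have Vc: "8 * \<gamma> * \<eta> * Lf\<^sup>2 * (lam\<^sup>2 * V) \<le> 9 * Lf\<^sup>2 / \<mu>\<^sup>2 * (\<gamma> * \<eta>) / 4 * V"
  proof -
    have "8 * lam\<^sup>2 \<le> 9 / \<mu>\<^sup>2 / 4"
      using lam pos by (simp add: power_mult_distrib field_simps)
    then have "(8 * lam\<^sup>2) * (\<gamma> * \<eta> * Lf\<^sup>2 * V) \<le> (9 / \<mu>\<^sup>2 / 4) * (\<gamma> * \<eta> * Lf\<^sup>2 * V)"
      using nn pos by (intro mult_right_mono) auto
    then show ?thesis by (simp add: ac_simps)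
  qed
  \<comment> \<open>The descent on \<open>F\<close> releases \<gamma>\<eta>/2 times
    \<open>W\<close>, and the dissipation claims half of it; the other half has to cover the three
    charges collected here.\<close>
  have Wc: "C * (\<gamma> * \<eta>)\<^sup>2 * W + A * (K + lam * \<eta> * (Lf\<^sup>2 * (\<gamma> * \<eta>)\<^sup>2)) * W + 8 * \<gamma> * \<eta> * Lf\<^sup>2 * (\<gamma>\<^sup>2 * W)
      \<le> \<gamma> * \<eta> / 4 * W"
  proof -
    let ?c = "C * \<gamma> * \<eta>
      + 9 * Lf\<^sup>2 * \<gamma>\<^sup>2 / (lam * \<mu>\<^sup>2) * (Lf\<^sup>2 / (lam * \<mu>\<^sup>2) + (Lf + Lf\<^sup>2 / \<mu>) * \<eta> + lam * \<eta>\<^sup>2 * Lf\<^sup>2)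
      + 8 * \<gamma>\<^sup>2 * Lf\<^sup>2"
    have "?c \<le> 1 / 4" unfolding C_def
      by (rule step_coefficient_bound) (use eta lam gam pos in auto)
    then have "?c * (\<gamma> * \<eta> * W) \<le> 1 / 4 * (\<gamma> * \<eta> * W)"
      using nn pos by (intro mult_right_mono) auto
    also have "?c * (\<gamma> * \<eta> * W) = C * (\<gamma> * \<eta>)\<^sup>2 * W + A * (K + lam * \<eta> * (Lf\<^sup>2 * (\<gamma> * \<eta>)\<^sup>2)) * W
        + 8 * \<gamma> * \<eta> * Lf\<^sup>2 * (\<gamma>\<^sup>2 * W)"
      by (simp add: K_def A algebra_simps power2_eq_square add_divide_distrib)
    finally show ?thesis by simp
  qed
  show ?thesis
    using Fs As Dc Vc Wc
    unfolding \<Delta>_def[symmetric] W_def[symmetric] V_def[symmetric] ex_def[symmetric] ey_def[symmetric] distrib_left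
    by linarith
qed

end

section \<open>Measurability, sample streams and momentum variance\<close>

text \<open>Stochastic gradients are measurable in the sample only at fixed points. Approximating
  \<open>Z\<close> by simple functions leaves finitely many fixed points at a time, and continuity
  carries measurability to the limit.\<close>

lemma Caratheodory_measurable_compose:
  fixes g :: "'a \<Rightarrow> 'z::{metric_space,second_countable_topology} \<Rightarrow> 'b::metric_space"
  assumes meas: "\<And>z. (\<lambda>\<xi>. g \<xi> z) \<in> borel_measurable M"
    and cont: "\<And>\<xi>. \<xi> \<in> space M \<Longrightarrow> continuous_on UNIV (g \<xi>)"
    and A: "A \<in> measurable N M" and Z: "Z \<in> borel_measurable N"
  shows "(\<lambda>\<omega>. g (A \<omega>) (Z \<omega>)) \<in> borel_measurable N"
proof -
  from borel_measurable_implies_sequence_metric[OF Z] obtain S where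
    S: "\<And>i. simple_function N (S i)" "\<And>\<omega>. \<omega> \<in> space N \<Longrightarrow> (\<lambda>i. S i \<omega>) \<longlonglongrightarrow> Z \<omega>"
    by blast
  show ?thesis
  proof (rule borel_measurable_LIMSEQ_metric[where f = "\<lambda>i \<omega>. g (A \<omega>) (S i \<omega>)"])
    fix i
    show "(\<lambda>\<omega>. g (A \<omega>) (S i \<omega>)) \<in> borel_measurable N"
    proof (rule measurable_compose_countable'[where f = "\<lambda>z \<omega>. g (A \<omega>) z" and I = "S i ` space N"])
      show "(\<lambda>\<omega>. g (A \<omega>) z) \<in> borel_measurable N" for z
        using measurable_compose[OF A meas] .
      show "S i \<in> measurable N (count_space (S i ` space N))"
        using simple_functionD[OF S(1)] by (subst measurable_count_space_eq2) auto
      show "countable (S i ` space N)"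
        by (intro countable_finite simple_functionD(1)[OF S(1)])
    qed
  next
    fix \<omega> assume \<omega>: "\<omega> \<in> space N"
    show "(\<lambda>i. g (A \<omega>) (S i \<omega>)) \<longlonglongrightarrow> g (A \<omega>) (Z \<omega>)"
      using continuous_on_tendsto_compose[OF cont[OF measurable_space[OF A \<omega>]] S(2)[OF \<omega>]] by simp
  qed
qed

text \<open>Two passes of the one-variable lemma. In the second one the parameter space is
  \<open>N\<close> itself with the identity map, so the already inserted \<open>Y \<omega>\<close>
  counts as part of the parameter.\<close>

lemma Caratheodory_measurable_compose2:
  fixes g :: "'a \<Rightarrow> 'x::{metric_space,second_countable_topology} \<Rightarrow>
      'y::{metric_space,second_countable_topology} \<Rightarrow> 'b::metric_space"
  assumes meas: "\<And>x y. (\<lambda>\<xi>. g \<xi> x y) \<in> borel_measurable M"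
    and cont_x: "\<And>\<xi> y. \<xi> \<in> space M \<Longrightarrow> continuous_on UNIV (\<lambda>x. g \<xi> x y)"
    and cont_y: "\<And>\<xi> x. \<xi> \<in> space M \<Longrightarrow> continuous_on UNIV (g \<xi> x)"
    and A: "A \<in> measurable N M" and X: "X \<in> borel_measurable N" and Y: "Y \<in> borel_measurable N"
  shows "(\<lambda>\<omega>. g (A \<omega>) (X \<omega>) (Y \<omega>)) \<in> borel_measurable N"
proof -
  have "(\<lambda>\<omega>. g (A \<omega>) x (Y \<omega>)) \<in> borel_measurable N" for x
    by (rule Caratheodory_measurable_compose[where M = M and g = "\<lambda>\<xi>. g \<xi> x", OF meas cont_y A Y])
  moreover have "continuous_on UNIV (\<lambda>x. g (A \<omega>) x (Y \<omega>))" if "\<omega> \<in> space N" for \<omega>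
    using cont_x measurable_space[OF A that] by blast
  ultimately show ?thesis
    using Caratheodory_measurable_compose[where M = N and N = N and A = "\<lambda>\<omega>. \<omega>"
        and g = "\<lambda>\<omega> x. g (A \<omega>) x (Y \<omega>)" and Z = X] X by simp
qed

lemma continuous_on_UNIV_of_norm_lipschitz:
  fixes g :: "'a::real_normed_vector \<Rightarrow> 'b::real_normed_vector"
  assumes "\<And>x x'. norm (g x - g x') \<le> L * norm (x - x')"
  shows "continuous_on UNIV g"
proof (rule lipschitz_on_continuous_on)
  show "\<bar>L\<bar>-lipschitz_on UNIV g"
  proof (rule lipschitz_onI)
    fix x y :: 'a
    have "L * norm (x - y) \<le> \<bar>L\<bar> * norm (x - y)" by (intro mult_right_mono) auto
    then show "dist (g x) (g y) \<le> \<bar>L\<bar> * dist x y"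
      using assms[of x y] by (simp add: dist_norm)
  qed simp
qed

section \<open>Fresh samples and second moments\<close>

context prob_space
begin

text \<open>This stands in for conditioning on the first \<open>n\<close> samples:
  \<open>h s\<close> sees only those, so the entry \<open>s !! n\<close> may be replaced by an
  independent copy. The induction peels off the head of the stream.\<close>

lemma nn_integral_stream_space_snth:
  assumes "case_prod h \<in> borel_measurable (stream_space M \<Otimes>\<^sub>M M)"
    and "\<And>s s'. (\<And>i. i < n \<Longrightarrow> s !! i = s' !! i) \<Longrightarrow> h s = h s'"
  shows "(\<integral>\<^sup>+s. h s (s !! n) \<partial>stream_space M) = (\<integral>\<^sup>+s. \<integral>\<^sup>+\<xi>. h s \<xi> \<partial>M \<partial>stream_space M)"
  using assms
proof (induction n arbitrary: h)
  case 0
  interpret S: prob_space "stream_space M" by (rule prob_space_stream_space)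
  obtain s0 where s0: "s0 \<in> space (stream_space M)" using S.not_empty by blast
  \<comment> \<open>For \<open>n = 0\<close> the agreement condition is vacuous, so \<open>h\<close>
    ignores its stream argument.\<close>
  have h: "h = (\<lambda>s. h s0)" using 0(2) by blast
  have [measurable]: "h s0 \<in> borel_measurable M"
    using measurable_compose[OF measurable_Pair1'[OF s0] 0(1)] by simp
  have "(\<integral>\<^sup>+s. h s (s !! 0) \<partial>stream_space M) = (\<integral>\<^sup>+s. h s0 (s !! 0) \<partial>stream_space M)"
    by (subst h) simp
  also have "\<dots> = (\<integral>\<^sup>+x. \<integral>\<^sup>+s. h s0 x \<partial>stream_space M \<partial>M)"
    by (subst nn_integral_stream_space) auto
  also have "\<dots> = (\<integral>\<^sup>+x. h s0 x \<partial>M)" by (simp add: S.emeasure_space_1)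
  also have "\<dots> = (\<integral>\<^sup>+s. \<integral>\<^sup>+\<xi>. h s \<xi> \<partial>M \<partial>stream_space M)"
    by (subst (2) h) (simp add: S.emeasure_space_1)
  finally show ?case .
next
  case (Suc n)
  note h[measurable] = Suc.prems(1)
  have [measurable]: "(\<lambda>s. h s (s !! Suc n)) \<in> borel_measurable (stream_space M)"
    using measurable_compose[OF _ h, of "\<lambda>s. (s, s !! Suc n)"] by (simp del: snth.simps)
  have [measurable]: "(\<lambda>s. \<integral>\<^sup>+\<xi>. h s \<xi> \<partial>M) \<in> borel_measurable (stream_space M)"
    by measurable
  have "(\<integral>\<^sup>+s. h s (s !! Suc n) \<partial>stream_space M) =
      (\<integral>\<^sup>+x. \<integral>\<^sup>+s. h (x ## s) (s !! n) \<partial>stream_space M \<partial>M)"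
    by (subst nn_integral_stream_space) auto
  also have "\<dots> = (\<integral>\<^sup>+x. \<integral>\<^sup>+s. \<integral>\<^sup>+\<xi>. h (x ## s) \<xi> \<partial>M \<partial>stream_space M \<partial>M)"
  proof (rule nn_integral_cong)
    fix x assume x: "x \<in> space M"
    show "(\<integral>\<^sup>+s. h (x ## s) (s !! n) \<partial>stream_space M) =
        (\<integral>\<^sup>+s. \<integral>\<^sup>+\<xi>. h (x ## s) \<xi> \<partial>M \<partial>stream_space M)"
    proof (rule Suc.IH)
      have "(\<lambda>p. (x ## fst p, snd p)) \<in> stream_space M \<Otimes>\<^sub>M M \<rightarrow>\<^sub>M stream_space M \<Otimes>\<^sub>M M"
        using x by measurable
      from measurable_compose[OF this h]
      show "(\<lambda>(s, \<xi>). h (x ## s) \<xi>) \<in> borel_measurable (stream_space M \<Otimes>\<^sub>M M)"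
        by (simp add: case_prod_beta)
      fix s s' :: "'a stream" assume "\<And>i. i < n \<Longrightarrow> s !! i = s' !! i"
      then show "h (x ## s) = h (x ## s')"
        by (intro Suc.prems(2)) (auto simp: Stream_snth split: nat.split)
    qed
  qed
  also have "\<dots> = (\<integral>\<^sup>+s. \<integral>\<^sup>+\<xi>. h s \<xi> \<partial>M \<partial>stream_space M)"
    by (subst (2) nn_integral_stream_space) auto
  finally show ?case .
qed

lemma nn_integral_norm_sq_shift:
  fixes Z :: "'a \<Rightarrow> 'b::euclidean_space"
  assumes Z: "integrable M Z" "(\<integral>\<xi>. Z \<xi> \<partial>M) = 0"
    and Z2: "integrable M (\<lambda>\<xi>. (norm (Z \<xi>))\<^sup>2)"
  shows "(\<integral>\<^sup>+\<xi>. ennreal ((norm (a + Z \<xi>))\<^sup>2) \<partial>M) =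
    ennreal ((norm a)\<^sup>2) + (\<integral>\<^sup>+\<xi>. ennreal ((norm (Z \<xi>))\<^sup>2) \<partial>M)"
proof -
  have eq: "(norm (a + Z \<xi>))\<^sup>2 = (norm a)\<^sup>2 + 2 * (a \<bullet> Z \<xi>) + (norm (Z \<xi>))\<^sup>2" for \<xi>
    by (simp add: power2_norm_eq_inner inner_add_left inner_add_right inner_commute)
  have I: "integrable M (\<lambda>\<xi>. a \<bullet> Z \<xi>)" using Z(1) by (rule integrable_inner_right)
  have I': "integrable M (\<lambda>\<xi>. (norm a)\<^sup>2 + 2 * (a \<bullet> Z \<xi>) + (norm (Z \<xi>))\<^sup>2)"
    using I Z2 by auto
  have "(\<integral>\<^sup>+\<xi>. ennreal ((norm (a + Z \<xi>))\<^sup>2) \<partial>M) =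
      ennreal (\<integral>\<xi>. (norm a)\<^sup>2 + 2 * (a \<bullet> Z \<xi>) + (norm (Z \<xi>))\<^sup>2 \<partial>M)"
    unfolding eq by (rule nn_integral_eq_integral[OF I']) (simp flip: eq)
  also have "(\<integral>\<xi>. (norm a)\<^sup>2 + 2 * (a \<bullet> Z \<xi>) + (norm (Z \<xi>))\<^sup>2 \<partial>M) =
      (norm a)\<^sup>2 + (\<integral>\<xi>. (norm (Z \<xi>))\<^sup>2 \<partial>M)"
    using I Z Z2 by (simp add: prob_space)
  also have "ennreal \<dots> = ennreal ((norm a)\<^sup>2) + (\<integral>\<^sup>+\<xi>. ennreal ((norm (Z \<xi>))\<^sup>2) \<partial>M)"
    using Z2 by (subst nn_integral_eq_integral) (auto simp: ennreal_plus)
  finally show ?thesis .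
qed

text \<open>With an infinite second moment the bound is trivial; a finite one gives the square
  integrability that the exact identity asks for.\<close>

lemma nn_integral_norm_sq_shift_le:
  fixes Z :: "'a \<Rightarrow> 'b::euclidean_space"
  assumes Z: "integrable M Z" "(\<integral>\<xi>. Z \<xi> \<partial>M) = 0"
  shows "(\<integral>\<^sup>+\<xi>. ennreal ((norm (a + Z \<xi>))\<^sup>2) \<partial>M) \<le>
    ennreal ((norm a)\<^sup>2) + (\<integral>\<^sup>+\<xi>. ennreal ((norm (Z \<xi>))\<^sup>2) \<partial>M)"
proof (cases "(\<integral>\<^sup>+\<xi>. ennreal ((norm (Z \<xi>))\<^sup>2) \<partial>M) = \<infinity>")
  case False
  then have "integrable M (\<lambda>\<xi>. (norm (Z \<xi>))\<^sup>2)"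
    using Z(1) by (intro integrableI_nonneg) (auto simp: top.not_eq_extremum)
  from nn_integral_norm_sq_shift[OF Z this] show ?thesis by simp
qed simp

lemma nn_integral_variance_le:
  fixes P :: "'a \<Rightarrow> 'b::euclidean_space"
  assumes P: "integrable M P" and B: "\<And>\<xi>. \<xi> \<in> space M \<Longrightarrow> norm (P \<xi>) \<le> B"
  shows "(\<integral>\<^sup>+\<xi>. ennreal ((norm (P \<xi> - (\<integral>\<xi>. P \<xi> \<partial>M)))\<^sup>2) \<partial>M) \<le> ennreal (B\<^sup>2)"
proof -
  define e where "e = (\<integral>\<xi>. P \<xi> \<partial>M)"
  define Z where "Z = (\<lambda>\<xi>. P \<xi> - e)"
  have Z: "integrable M Z" "(\<integral>\<xi>. Z \<xi> \<partial>M) = 0"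
    using P by (auto simp: Z_def e_def prob_space)
  have "integrable M (\<lambda>\<xi>. (norm (Z \<xi>))\<^sup>2)"
  proof (rule integrable_const_bound[where B = "(B + norm e)\<^sup>2"])
    show "(\<lambda>\<xi>. (norm (Z \<xi>))\<^sup>2) \<in> borel_measurable M" using Z(1) by auto
    have "norm (Z \<xi>) \<le> B + norm e" if "\<xi> \<in> space M" for \<xi>
      using B[OF that] norm_triangle_ineq4[of "P \<xi>" e] by (simp add: Z_def)
    then show "AE \<xi> in M. norm ((norm (Z \<xi>))\<^sup>2) \<le> (B + norm e)\<^sup>2"
      by (intro AE_I2) (simp add: power_mono)
  qed
  from nn_integral_norm_sq_shift[OF Z this, of e]
  have "(\<integral>\<^sup>+\<xi>. ennreal ((norm (Z \<xi>))\<^sup>2) \<partial>M) \<le> (\<integral>\<^sup>+\<xi>. ennreal ((norm (P \<xi>))\<^sup>2) \<partial>M)"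
    by (simp add: Z_def)
  also have "\<dots> \<le> (\<integral>\<^sup>+\<xi>. ennreal (B\<^sup>2) \<partial>M)"
    using B by (intro nn_integral_mono ennreal_leI power_mono) auto
  also have "\<dots> = ennreal (B\<^sup>2)" by (simp add: emeasure_space_1)
  finally show ?thesis by (simp add: Z_def e_def)
qed

text \<open>The error of the momentum estimator is \<open>(1 - \<beta>)\<close> times the old error plus a centred term;
  the cross term vanishes in expectation, which is where the contraction comes from.\<close>

lemma momentum_error_bound:
  fixes U U0 :: "'a \<Rightarrow> 'b::euclidean_space"
  assumes U: "integrable M U" "(\<integral>\<xi>. U \<xi> \<partial>M) = u" and U0: "integrable M U0" "(\<integral>\<xi>. U0 \<xi> \<partial>M) = u0"
    and B: "\<And>\<xi>. \<xi> \<in> space M \<Longrightarrow> norm (U \<xi> - U0 \<xi>) \<le> B"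
    and \<beta>: "0 \<le> \<beta>" "\<beta> \<le> 1"
  shows "(\<integral>\<^sup>+\<xi>. ennreal ((norm (u - (U \<xi> + (1 - \<beta>) *\<^sub>R (w - U0 \<xi>))))\<^sup>2) \<partial>M) \<le>
    ennreal ((1 - \<beta>)\<^sup>2 * (norm (u0 - w))\<^sup>2 + 2 * B\<^sup>2) + ennreal (2 * \<beta>\<^sup>2) * (\<integral>\<^sup>+\<xi>. ennreal ((norm (u - U \<xi>))\<^sup>2) \<partial>M)"
proof -
  \<comment> \<open>Both gradients use the same sample, so \<open>P\<close> is bounded pointwise by
    \<open>B\<close>, which the application takes proportional to the displacement. Its variance is
    therefore small even where that of \<open>U\<close> is not.\<close>
  define P where "P = (\<lambda>\<xi>. U \<xi> - U0 \<xi>)"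
  \<comment> \<open>The centred remainder: a fraction \<open>\<beta>\<close> of the sampling error,
    minus the damped fluctuation of \<open>P\<close> around its mean.\<close>
  define Z where "Z = (\<lambda>\<xi>. \<beta> *\<^sub>R (u - U \<xi>) - (1 - \<beta>) *\<^sub>R (P \<xi> - (u - u0)))"
  have P: "integrable M P" "(\<integral>\<xi>. P \<xi> \<partial>M) = u - u0" using U U0 by (auto simp: P_def)
  have [measurable]: "U \<in> borel_measurable M" "P \<in> borel_measurable M"
    using U(1) P(1) by auto
  have Z: "integrable M Z" "(\<integral>\<xi>. Z \<xi> \<partial>M) = 0"
    using U P by (auto simp: Z_def prob_space)
  have "u - (U \<xi> + (1 - \<beta>) *\<^sub>R (w - U0 \<xi>)) = (1 - \<beta>) *\<^sub>R (u0 - w) + Z \<xi>" for \<xi>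
    by (simp add: Z_def P_def algebra_simps)
  then have "(\<integral>\<^sup>+\<xi>. ennreal ((norm (u - (U \<xi> + (1 - \<beta>) *\<^sub>R (w - U0 \<xi>))))\<^sup>2) \<partial>M) \<le>
      ennreal ((norm ((1 - \<beta>) *\<^sub>R (u0 - w)))\<^sup>2) + (\<integral>\<^sup>+\<xi>. ennreal ((norm (Z \<xi>))\<^sup>2) \<partial>M)"
    using nn_integral_norm_sq_shift_le[OF Z, of "(1 - \<beta>) *\<^sub>R (u0 - w)"] by (simp del: norm_scaleR)
  also have "(norm ((1 - \<beta>) *\<^sub>R (u0 - w)))\<^sup>2 = (1 - \<beta>)\<^sup>2 * (norm (u0 - w))\<^sup>2"
    by (simp add: power_mult_distrib)
  also have "(\<integral>\<^sup>+\<xi>. ennreal ((norm (Z \<xi>))\<^sup>2) \<partial>M) \<le>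
      (\<integral>\<^sup>+\<xi>. ennreal (2 * \<beta>\<^sup>2) * ennreal ((norm (u - U \<xi>))\<^sup>2) +
        ennreal 2 * ennreal ((norm (P \<xi> - (u - u0)))\<^sup>2) \<partial>M)"
  proof (rule nn_integral_mono)
    fix \<xi>
    let ?p = "\<beta> * norm (u - U \<xi>)" and ?q = "norm (P \<xi> - (u - u0))"
    have "(1 - \<beta>) * ?q \<le> 1 * ?q" using \<beta> by (intro mult_right_mono) auto
    then have "norm (Z \<xi>) \<le> ?p + ?q"
      using norm_triangle_ineq4[of "\<beta> *\<^sub>R (u - U \<xi>)" "(1 - \<beta>) *\<^sub>R (P \<xi> - (u - u0))"] \<beta>
      by (simp add: Z_def)
    then have "(norm (Z \<xi>))\<^sup>2 \<le> (?p + ?q)\<^sup>2" by (intro power_mono) auto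
    also have "\<dots> \<le> 2 * ?p\<^sup>2 + 2 * ?q\<^sup>2"
      using zero_le_power2[of "?p - ?q"] by (simp add: power2_eq_square algebra_simps)
    finally have "(norm (Z \<xi>))\<^sup>2 \<le> 2 * \<beta>\<^sup>2 * (norm (u - U \<xi>))\<^sup>2 + 2 * ?q\<^sup>2"
      by (simp add: power_mult_distrib)
    then show "ennreal ((norm (Z \<xi>))\<^sup>2) \<le> ennreal (2 * \<beta>\<^sup>2) * ennreal ((norm (u - U \<xi>))\<^sup>2) +
        ennreal 2 * ennreal (?q\<^sup>2)"
      by (simp flip: ennreal_mult ennreal_plus add: ennreal_leI del: ennreal_numeral)
  qed
  also have "\<dots> = ennreal (2 * \<beta>\<^sup>2) * (\<integral>\<^sup>+\<xi>. ennreal ((norm (u - U \<xi>))\<^sup>2) \<partial>M) +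
      ennreal 2 * (\<integral>\<^sup>+\<xi>. ennreal ((norm (P \<xi> - (u - u0)))\<^sup>2) \<partial>M)"
    by (subst nn_integral_add) (auto simp: nn_integral_cmult)
  also have "\<dots> \<le> ennreal (2 * \<beta>\<^sup>2) * (\<integral>\<^sup>+\<xi>. ennreal ((norm (u - U \<xi>))\<^sup>2) \<partial>M) + ennreal 2 * ennreal (B\<^sup>2)"
    using nn_integral_variance_le[OF P(1), of B] B
    by (intro add_left_mono mult_left_mono) (auto simp: P(2), auto simp: P_def)
  also have "ennreal 2 * ennreal (B\<^sup>2) = ennreal (2 * B\<^sup>2)"
    by (simp add: ennreal_mult del: ennreal_numeral)
  finally show ?thesis
    by (simp add: ennreal_plus ac_simps)
qed

end

section \<open>Step-size estimates\<close>

lemma cube_root_pow: "0 \<le> (x::real) \<Longrightarrow> (x powr (1 / 3)) ^ 3 = x"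
  by (cases "x = 0") (simp_all add: powr_power)

lemma le_cube_root:
  fixes a m :: real
  assumes "0 \<le> a" "a ^ 3 \<le> m"
  shows "a \<le> m powr (1 / 3)"
proof -
  have "0 \<le> m" using assms zero_le_power[of a 3] by linarith
  then show ?thesis
    using assms power_mono_iff[of a "m powr (1 / 3)" 3] by (simp add: cube_root_pow)
qed

text \<open>With a and b the cube roots of x and x + 1, factoring b^3 - a^3 = 1 leaves the cofactor
  a^2 + ab + b^2, which is at least 3ab and hence at least 3kb. This would give 1/(3 k^3); a factor
  two is given away to match the lower bounds on \<open>c1\<close> and \<open>c2\<close>.\<close>

lemma inverse_step_increment:
  fixes k x :: real
  assumes k: "0 < k" "k ^ 3 \<le> x"
  shows "(x + 1) powr (1 / 3) / k - x powr (1 / 3) / k \<le> 2 / (3 * k ^ 3) * (k / (x + 1) powr (1 / 3))"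
proof -
  define a where "a = x powr (1 / 3)"
  define b where "b = (x + 1) powr (1 / 3)"
  have x: "0 < x" using k by (meson zero_less_power less_le_trans)
  have ab: "0 < a" "a \<le> b" "0 < b" using x by (auto simp: a_def b_def intro!: powr_mono2)
  have ka: "k \<le> a" unfolding a_def using k by (intro le_cube_root) auto
  have "b ^ 3 - a ^ 3 = 1" using x by (simp add: a_def b_def cube_root_pow)
  then have "(b - a) * (a\<^sup>2 + a * b + b\<^sup>2) = 1"
    by (simp add: power2_eq_square power3_eq_cube algebra_simps)
  moreover have "(b - a) * (3 * (a * b)) \<le> (b - a) * (a\<^sup>2 + a * b + b\<^sup>2)"
    using ab zero_le_power2[of "a - b"]
    by (intro mult_left_mono) (auto simp: power2_eq_square algebra_simps)
  moreover have "(b - a) * (3 * (k * b)) \<le> (b - a) * (3 * (a * b))"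
    using ab ka by (intro mult_left_mono mult_right_mono) auto
  ultimately have "(b - a) * b * k \<le> 2 / 3" by (simp add: algebra_simps)
  then have "(b - a) * b * k / (k\<^sup>2 * b) \<le> 2 / 3 / (k\<^sup>2 * b)"
    using ab by (intro divide_right_mono) auto
  then have "(b - a) / k \<le> 2 / (3 * k ^ 3) * (k / b)"
    using k ab by (simp add: power2_eq_square power3_eq_cube)
  then show ?thesis by (simp add: a_def b_def diff_divide_distrib)
qed

lemma sum_inverse_le_ln:
  fixes m :: real
  assumes "m \<ge> 1"
  shows "(\<Sum>n<T. 1 / (m + real (Suc n))) \<le> ln (m + real T)"
proof (induction T)
  case 0
  then show ?case using assms by simp
next
  case (Suc T)
  define x where "x = m + real T"
  have x: "x > 0" using assms by (simp add: x_def)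
  have "ln (x / (x + 1)) \<le> x / (x + 1) - 1" using x by (intro ln_le_minus_one) simp
  also have "\<dots> = - (1 / (x + 1))" using x by (simp add: field_simps)
  finally have "1 / (x + 1) \<le> ln (x + 1) - ln x" using x by (simp add: ln_div)
  then show ?case using Suc by (simp add: x_def add.assoc add.commute[of 1])
qed

text \<open>The linear bounds are optimal at c = sqrt (Q / T). For Q = 0 no positive
  \<open>c\<close> is optimal, hence the separate limit argument.\<close>

lemma le_ennreal_sqrt_of_AM_GM:
  assumes Q: "0 \<le> Q" and T: "0 < T"
    and S: "\<And>c. c > 0 \<Longrightarrow> S \<le> ennreal (Q / (2 * c) + T * c / 2)"
  shows "S \<le> ennreal (sqrt (Q * T))"
proof (cases "Q = 0")
  case True
  have "S \<le> 0 + ennreal e" if "e > 0" for e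
    using S[of "2 * e / T"] True that T by simp
  then have "S \<le> 0" by (rule ennreal_le_epsilon)
  then show ?thesis by simp
next
  case False
  then have Q: "Q > 0" using Q by simp
  define p q where "p = sqrt Q" and "q = sqrt T"
  have pq: "p > 0" "q > 0" "Q = p * p" "T = q * q" using Q T by (auto simp: p_def q_def)
  have "Q / (2 * (p / q)) + T * (p / q) / 2 = p * q"
    using pq by (simp add: field_simps)
  also have "\<dots> = sqrt (Q * T)" by (simp add: p_def q_def real_sqrt_mult)
  finally have eq: "Q / (2 * (p / q)) + T * (p / q) / 2 = sqrt (Q * T)" .
  have "p / q > 0" using pq by simp
  from S[OF this] show ?thesis unfolding eq .
qed

lemma powr_sixth_add_le:
  fixes a b :: real
  assumes "0 \<le> a" "0 \<le> b"
  shows "(a + b) powr (1 / 6) \<le> a powr (1 / 6) + b powr (1 / 6)"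
proof -
  define u v where "u = a powr (1 / 6)" and "v = b powr (1 / 6)"
  have uv: "0 \<le> u" "0 \<le> v" by (auto simp: u_def v_def)
  have root: "(x powr (1 / 6)) ^ 6 = x" if "0 \<le> x" for x :: real
    using that by (cases "x = 0") (simp_all add: powr_power)
  have "((a + b) powr (1 / 6)) ^ 6 = u ^ 6 + v ^ 6"
    using assms by (simp add: root u_def v_def)
  also have "\<dots> \<le> (u + v) ^ 6"
  proof -
    have "(u + v) ^ 6 = (u + v) * (u + v) ^ 5" by (simp add: eval_nat_numeral)
    moreover have "u * u ^ 5 \<le> u * (u + v) ^ 5" "v * v ^ 5 \<le> v * (u + v) ^ 5"
      using uv by (intro mult_left_mono power_mono; simp)+
    ultimately show ?thesis by (simp add: distrib_right eval_nat_numeral)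
  qed
  finally show ?thesis
    using uv power_mono_iff[of "(a + b) powr (1 / 6)" "u + v" 6] by (simp add: u_def v_def)
qed

lemma (in prob_space) norm_expectation_diff_le:
  fixes U V :: "'a \<Rightarrow> 'b::euclidean_space"
  assumes "integrable M U" "integrable M V" "\<And>\<xi>. \<xi> \<in> space M \<Longrightarrow> norm (U \<xi> - V \<xi>) \<le> B"
  shows "norm ((\<integral>\<xi>. U \<xi> \<partial>M) - (\<integral>\<xi>. V \<xi> \<partial>M)) \<le> B"
proof -
  have "norm (\<integral>\<xi>. U \<xi> - V \<xi> \<partial>M) \<le> (\<integral>\<xi>. norm (U \<xi> - V \<xi>) \<partial>M)"
    by (rule integral_norm_bound)
  also have "\<dots> \<le> (\<integral>\<xi>. B \<partial>M)"
    using assms by (intro integral_mono) auto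
  finally show ?thesis using assms by (simp add: prob_space)
qed

section \<open>Expected Lyapunov decrease along MSGDA\<close>

text \<open>The parameter bounds appear in the form in which the estimates use them:
  \<open>lam_sq\<close> is free of the root, and \<open>gam_le\<close> of the division by the
  smoothness constant.\<close>

locale msgda_run = pl_minimax f Gx Gy \<mu> Lf + prob_space D
  for f :: "'x::euclidean_space \<Rightarrow> 'y::euclidean_space \<Rightarrow> real" and Gx Gy \<mu> Lf and D :: "'a measure" +
  fixes gx :: "'a \<Rightarrow> 'x \<Rightarrow> 'y \<Rightarrow> 'x" and gy :: "'a \<Rightarrow> 'x \<Rightarrow> 'y \<Rightarrow> 'y"
    and \<sigma> k m c1 c2 lam \<gamma> :: real and \<eta> \<alpha> \<beta> :: "nat \<Rightarrow> real" and x1 :: 'x and y1 :: 'y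
  assumes Lx_x: "\<xi> \<in> space D \<Longrightarrow> norm (gx \<xi> x y - gx \<xi> x' y) \<le> Lf * norm (x - x')"
    and Lx_y: "\<xi> \<in> space D \<Longrightarrow> norm (gx \<xi> x y - gx \<xi> x y') \<le> Lf * norm (y - y')"
    and Ly_x: "\<xi> \<in> space D \<Longrightarrow> norm (gy \<xi> x y - gy \<xi> x' y) \<le> Lf * norm (x - x')"
    and Ly_y: "\<xi> \<in> space D \<Longrightarrow> norm (gy \<xi> x y - gy \<xi> x y') \<le> Lf * norm (y - y')"
    and gx_int: "integrable D (\<lambda>\<xi>. gx \<xi> x y)"
    and gy_int: "integrable D (\<lambda>\<xi>. gy \<xi> x y)"
    and unbiased_x: "(\<integral>\<xi>. gx \<xi> x y \<partial>D) = Gx x y"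
    and unbiased_y: "(\<integral>\<xi>. gy \<xi> x y \<partial>D) = Gy x y"
    and variance: "(\<integral>\<^sup>+\<xi>. ennreal ((norm (Gx x y - gx \<xi> x y))\<^sup>2 + (norm (Gy x y - gy \<xi> x y))\<^sup>2) \<partial>D)
        \<le> ennreal (\<sigma>\<^sup>2)"
    and bdd: "bdd_below (range (Fmax f))"
    and eta: "\<eta> t = k / (m + real t) powr (1/3)"
    and alpha: "\<alpha> (Suc t) = c1 * (\<eta> t)\<^sup>2"
    and beta: "\<beta> (Suc t) = c2 * (\<eta> t)\<^sup>2"
    and k_pos: "k > 0"
    and m_ge: "m \<ge> 2" "k ^ 3 \<le> m" "(c1 * k) ^ 3 \<le> m" "(c2 * k) ^ 3 \<le> m"
    and c1_ge: "c1 \<ge> 2 / (3 * k ^ 3) + 9 * Lf\<^sup>2 / \<mu>\<^sup>2"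
    and c2_ge: "c2 \<ge> 2 / (3 * k ^ 3) + 9 / 4"
    and lam_pos: "0 < lam"
    and lam_sq: "(lam * \<mu>)\<^sup>2 \<le> 9 / 32"
    and lam_le: "lam \<le> m powr (1/3) / (2 * Lf * k)"
    and gam_pos: "0 < \<gamma>"
    and gam_le: "\<gamma> * (Lf * (1 + (Lf / \<mu>) / 2)) \<le> lam * \<mu> / 16"
begin

section \<open>Step sizes along the run\<close>

lemma c_pos: "c1 > 0" "c2 > 0"
proof -
  have "0 < 2 / (3 * k ^ 3)" using k_pos by simp
  moreover have "0 \<le> 9 * Lf\<^sup>2 / \<mu>\<^sup>2" by simp
  ultimately show "c1 > 0" "c2 > 0" using c1_ge c2_ge by linarith+
qed

lemma eta_pos: "\<eta> t > 0"
  using k_pos m_ge(1) by (simp add: eta)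

lemma eta_antimono: "s \<le> t \<Longrightarrow> \<eta> t \<le> \<eta> s"
  unfolding eta using k_pos m_ge(1) by (intro divide_left_mono powr_mono2) auto

lemma scaled_eta_le_1:
  assumes "0 < c" "(c * k) ^ 3 \<le> m"
  shows "c * \<eta> t \<le> 1"
proof -
  have "c * k \<le> (m + real t) powr (1/3)"
    using assms k_pos m_ge(1) by (intro le_cube_root) auto
  then show ?thesis using m_ge(1) by (simp add: eta field_simps)
qed

lemma eta_le_1: "\<eta> t \<le> 1"
  using scaled_eta_le_1[of 1] m_ge(2) by simp

lemma lam_eta: "lam * \<eta> t * Lf \<le> 1 / 2"
proof -
  have "lam * \<eta> t \<le> lam * (k / m powr (1/3))"
    unfolding eta using k_pos m_ge(1) lam_pos
    by (intro mult_left_mono divide_left_mono powr_mono2) auto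
  also have "\<dots> \<le> m powr (1/3) / (2 * Lf * k) * (k / m powr (1/3))"
    using lam_le k_pos by (intro mult_right_mono) auto
  also have "\<dots> = 1 / (2 * Lf)" using k_pos m_ge(1) by (simp add: field_simps)
  finally show ?thesis using Lf_pos by (simp add: field_simps)
qed

lemma alpha_bounds: "0 \<le> \<alpha> (Suc t)" "\<alpha> (Suc t) \<le> 1" and beta_bounds: "0 \<le> \<beta> (Suc t)" "\<beta> (Suc t) \<le> 1"
proof -
  have *: "0 \<le> c * (\<eta> t)\<^sup>2" "c * (\<eta> t)\<^sup>2 \<le> 1" if "0 < c" "(c * k) ^ 3 \<le> m" for c
  proof -
    show "0 \<le> c * (\<eta> t)\<^sup>2" using that by simp
    have "(c * \<eta> t) * \<eta> t \<le> 1 * 1"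
      using scaled_eta_le_1[OF that] eta_le_1 eta_pos[of t] that by (intro mult_mono) auto
    then show "c * (\<eta> t)\<^sup>2 \<le> 1" by (simp add: power2_eq_square mult.assoc)
  qed
  show "0 \<le> \<alpha> (Suc t)" "\<alpha> (Suc t) \<le> 1" "0 \<le> \<beta> (Suc t)" "\<beta> (Suc t) \<le> 1"
    using * c_pos m_ge by (simp_all add: alpha beta)
qed

text \<open>The weight 1/\<eta> of the error grows as the step size shrinks. The summand 2/(3 k^3)
  of \<open>c\<close> absorbs this growth, and \<open>d\<close> is left over as genuine
  decay.\<close>

lemma momentum_contraction:
  assumes c: "c \<ge> 2 / (3 * k ^ 3) + d" and b: "c * (\<eta> (Suc n))\<^sup>2 \<le> 1" "0 < c"
  shows "(1 - c * (\<eta> (Suc n))\<^sup>2)\<^sup>2 / \<eta> (Suc n) \<le> 1 / \<eta> n - d * \<eta> (Suc n)"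
proof -
  let ?e = "\<eta> (Suc n)"
  let ?b = "c * ?e\<^sup>2"
  have e: "?e > 0" by (rule eta_pos)
  have "(1 - ?b)\<^sup>2 \<le> 1 - ?b"
  proof -
    have "(1 - ?b) * (1 - ?b) \<le> (1 - ?b) * 1" using b by (intro mult_left_mono) auto
    then show ?thesis by (simp add: power2_eq_square)
  qed
  then have "(1 - ?b)\<^sup>2 / ?e \<le> (1 - ?b) / ?e" using e by (intro divide_right_mono) auto
  also have "\<dots> = 1 / ?e - c * ?e" using e by (simp add: field_simps power2_eq_square)
  also have "1 / ?e \<le> 1 / \<eta> n + 2 / (3 * k ^ 3) * ?e"
    using inverse_step_increment[OF k_pos, of "m + real n"] m_ge(1,2)
    by (simp add: eta add.assoc add.commute[of 1])
  finally have "(1 - ?b)\<^sup>2 / ?e \<le> 1 / \<eta> n + (2 / (3 * k ^ 3) - c) * ?e" by (simp add: algebra_simps)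
  also have "\<dots> \<le> 1 / \<eta> n + (- d) * ?e"
    using c e by (intro add_left_mono mult_right_mono) auto
  finally show ?thesis by simp
qed

section \<open>The Lyapunov function and its expected decrease from a given state\<close>

definition A where "A = 9 * \<gamma> * Lf\<^sup>2 / (lam * \<mu>\<^sup>2)"

definition "Fstar = (INF x. F x)"

text \<open>State \<open>n\<close> belongs to time n + 1. The errors are thus weighted with the step
  size that led to the state, while \<open>dissipation\<close> and \<open>next_state\<close> use the
  one that leaves it; the initial weight involves \<open>\<eta> 0\<close>.\<close>

fun lyap :: "nat \<Rightarrow> 'x \<times> 'y \<times> 'y \<times> 'x \<Rightarrow> real" where
  "lyap n (x, y, v, w) = F x - Fstar + A * (F x - f x y)
    + \<gamma> / \<eta> n * ((norm (Gx x y - w))\<^sup>2 + (norm (Gy x y - v))\<^sup>2)"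

fun dissipation :: "nat \<Rightarrow> 'x \<times> 'y \<times> 'y \<times> 'x \<Rightarrow> real" where
  "dissipation n (x, y, v, w) = \<gamma> * \<eta> (Suc n) / 4
    * ((norm w)\<^sup>2 + 2 * Lf\<^sup>2 / \<mu> * (F x - f x y) + (norm (Gx x y - w))\<^sup>2)"

text \<open>Separates the fresh sample from the state, so that one transition can be integrated over
  the sample with the state held fixed.\<close>

fun next_state :: "nat \<Rightarrow> 'x \<times> 'y \<times> 'y \<times> 'x \<Rightarrow> 'a \<Rightarrow> 'x \<times> 'y \<times> 'y \<times> 'x" where
  "next_state n (x, y, v, w) \<xi> =
    (let x' = x - (\<gamma> * \<eta> (Suc n)) *\<^sub>R w; y' = y + (lam * \<eta> (Suc n)) *\<^sub>R v
     in (x', y', gy \<xi> x' y' + (1 - \<alpha> (Suc (Suc n))) *\<^sub>R (v - gy \<xi> x y),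
         gx \<xi> x' y' + (1 - \<beta> (Suc (Suc n))) *\<^sub>R (w - gx \<xi> x y)))"

lemma A_pos: "A > 0"
  unfolding A_def using gam_pos lam_pos mu_pos Lf_pos by (intro divide_pos_pos mult_pos_pos) auto

lemma Fstar_le: "Fstar \<le> F x"
  unfolding Fstar_def using bdd by (intro cINF_lower) auto

lemma lyap_nonneg: "0 \<le> lyap n z"
proof (cases z)
  case (fields x y v w)
  show ?thesis unfolding fields lyap.simps
    using Fstar_le[of x] f_le_F[of x y] A_pos gam_pos eta_pos[of n]
    by (intro add_nonneg_nonneg mult_nonneg_nonneg) auto
qed

lemma dissipation_nonneg: "0 \<le> dissipation n z"
proof (cases z)
  case (fields x y v w)
  show ?thesis unfolding fields dissipation.simps
    using f_le_F[of x y] mu_pos gam_pos eta_pos[of "Suc n"]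
    by (intro add_nonneg_nonneg mult_nonneg_nonneg divide_nonneg_nonneg) auto
qed

lemma gx_diff: "\<xi> \<in> space D \<Longrightarrow> norm (gx \<xi> x' y' - gx \<xi> x y) \<le> Lf * (norm (x' - x) + norm (y' - y))"
  using norm_triangle_ineq[of "gx \<xi> x' y' - gx \<xi> x y'" "gx \<xi> x y' - gx \<xi> x y"]
    Lx_x[of \<xi> x' y' x] Lx_y[of \<xi> x y' y] by (simp add: distrib_left)

lemma gy_diff: "\<xi> \<in> space D \<Longrightarrow> norm (gy \<xi> x' y' - gy \<xi> x y) \<le> Lf * (norm (x' - x) + norm (y' - y))"
  using norm_triangle_ineq[of "gy \<xi> x' y' - gy \<xi> x y'" "gy \<xi> x y' - gy \<xi> x y"]
    Ly_x[of \<xi> x' y' x] Ly_y[of \<xi> x y' y] by (simp add: distrib_left)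

lemma expected_error_bound:
  assumes a: "0 \<le> a" "a \<le> 1" and b: "0 \<le> b" "b \<le> 1"
  shows "(\<integral>\<^sup>+\<xi>. ennreal ((norm (Gx x' y' - (gx \<xi> x' y' + (1 - b) *\<^sub>R (w - gx \<xi> x y))))\<^sup>2
      + (norm (Gy x' y' - (gy \<xi> x' y' + (1 - a) *\<^sub>R (v - gy \<xi> x y))))\<^sup>2) \<partial>D)
    \<le> ennreal ((1 - b)\<^sup>2 * (norm (Gx x y - w))\<^sup>2 + (1 - a)\<^sup>2 * (norm (Gy x y - v))\<^sup>2
      + 8 * Lf\<^sup>2 * ((norm (x' - x))\<^sup>2 + (norm (y' - y))\<^sup>2) + 2 * (a\<^sup>2 + b\<^sup>2) * \<sigma>\<^sup>2)"
proof -
  define B where "B = Lf * (norm (x' - x) + norm (y' - y))"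
  define Ix where "Ix = (\<integral>\<^sup>+\<xi>. ennreal ((norm (Gx x' y' - gx \<xi> x' y'))\<^sup>2) \<partial>D)"
  define Iy where "Iy = (\<integral>\<^sup>+\<xi>. ennreal ((norm (Gy x' y' - gy \<xi> x' y'))\<^sup>2) \<partial>D)"
  define px where "px = (1 - b)\<^sup>2 * (norm (Gx x y - w))\<^sup>2 + 2 * B\<^sup>2"
  define py where "py = (1 - a)\<^sup>2 * (norm (Gy x y - v))\<^sup>2 + 2 * B\<^sup>2"
  have [measurable]: "(\<lambda>\<xi>. gx \<xi> x y) \<in> borel_measurable D" "(\<lambda>\<xi>. gy \<xi> x y) \<in> borel_measurable D" for x y
    using gx_int gy_int by auto
  have nn: "0 \<le> px" "0 \<le> py" by (simp_all add: px_def py_def)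
  have "Ix + Iy \<le> ennreal (\<sigma>\<^sup>2)"
    unfolding Ix_def Iy_def
    by (subst nn_integral_add[symmetric]) (auto simp flip: ennreal_plus intro: variance)
  \<comment> \<open>The variance hypothesis bounds the sum of the two variances, so both weights are
    raised to a common value first.\<close>
  have "ennreal (2 * b\<^sup>2) * Ix + ennreal (2 * a\<^sup>2) * Iy
      \<le> ennreal (2 * (a\<^sup>2 + b\<^sup>2)) * Ix + ennreal (2 * (a\<^sup>2 + b\<^sup>2)) * Iy"
    by (intro add_mono mult_right_mono ennreal_leI) auto
  also have "\<dots> = ennreal (2 * (a\<^sup>2 + b\<^sup>2)) * (Ix + Iy)" by (simp add: distrib_left)
  also have "\<dots> \<le> ennreal (2 * (a\<^sup>2 + b\<^sup>2)) * ennreal (\<sigma>\<^sup>2)"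
    by (intro mult_left_mono) (auto intro: \<open>Ix + Iy \<le> ennreal (\<sigma>\<^sup>2)\<close>)
  also have "\<dots> = ennreal (2 * (a\<^sup>2 + b\<^sup>2) * \<sigma>\<^sup>2)" by (simp add: ennreal_mult)
  finally have I: "ennreal (2 * b\<^sup>2) * Ix + ennreal (2 * a\<^sup>2) * Iy \<le> \<dots>" .
  have "(\<integral>\<^sup>+\<xi>. ennreal ((norm (Gx x' y' - (gx \<xi> x' y' + (1 - b) *\<^sub>R (w - gx \<xi> x y))))\<^sup>2
      + (norm (Gy x' y' - (gy \<xi> x' y' + (1 - a) *\<^sub>R (v - gy \<xi> x y))))\<^sup>2) \<partial>D) =
    (\<integral>\<^sup>+\<xi>. ennreal ((norm (Gx x' y' - (gx \<xi> x' y' + (1 - b) *\<^sub>R (w - gx \<xi> x y))))\<^sup>2) \<partial>D)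
      + (\<integral>\<^sup>+\<xi>. ennreal ((norm (Gy x' y' - (gy \<xi> x' y' + (1 - a) *\<^sub>R (v - gy \<xi> x y))))\<^sup>2) \<partial>D)"
    by (subst nn_integral_add[symmetric]) (auto simp flip: ennreal_plus)
  also have "\<dots> \<le> (ennreal px + ennreal (2 * b\<^sup>2) * Ix) + (ennreal py + ennreal (2 * a\<^sup>2) * Iy)"
    unfolding px_def py_def Ix_def Iy_def
    by (intro add_mono momentum_error_bound gx_int gy_int unbiased_x unbiased_y a b)
      (auto simp: B_def gx_diff gy_diff)
  also have "\<dots> = ennreal (px + py) + (ennreal (2 * b\<^sup>2) * Ix + ennreal (2 * a\<^sup>2) * Iy)"
    using nn by (simp add: ac_simps)
  also have "\<dots> \<le> ennreal (px + py) + ennreal (2 * (a\<^sup>2 + b\<^sup>2) * \<sigma>\<^sup>2)"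
    using I by (rule add_left_mono)
  also have "\<dots> = ennreal (px + py + 2 * (a\<^sup>2 + b\<^sup>2) * \<sigma>\<^sup>2)"
    using nn by (simp add: ennreal_plus)
  also have "\<dots> \<le> ennreal ((1 - b)\<^sup>2 * (norm (Gx x y - w))\<^sup>2 + (1 - a)\<^sup>2 * (norm (Gy x y - v))\<^sup>2
      + 8 * Lf\<^sup>2 * ((norm (x' - x))\<^sup>2 + (norm (y' - y))\<^sup>2) + 2 * (a\<^sup>2 + b\<^sup>2) * \<sigma>\<^sup>2)"
  proof (rule ennreal_leI)
    have "(norm (x' - x) + norm (y' - y))\<^sup>2 \<le> 2 * ((norm (x' - x))\<^sup>2 + (norm (y' - y))\<^sup>2)"
      using zero_le_power2[of "norm (x' - x) - norm (y' - y)"]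
      by (simp add: power2_eq_square algebra_simps)
    then have "4 * Lf\<^sup>2 * (norm (x' - x) + norm (y' - y))\<^sup>2
        \<le> 4 * Lf\<^sup>2 * (2 * ((norm (x' - x))\<^sup>2 + (norm (y' - y))\<^sup>2))"
      by (intro mult_left_mono) auto
    moreover have "4 * B\<^sup>2 = 4 * Lf\<^sup>2 * (norm (x' - x) + norm (y' - y))\<^sup>2"
      by (simp add: B_def power_mult_distrib)
    moreover have "4 * Lf\<^sup>2 * (2 * q) = 8 * Lf\<^sup>2 * q" for q by simp
    ultimately have "4 * B\<^sup>2 \<le> 8 * Lf\<^sup>2 * ((norm (x' - x))\<^sup>2 + (norm (y' - y))\<^sup>2)"
      by metis
    then show "px + py + 2 * (a\<^sup>2 + b\<^sup>2) * \<sigma>\<^sup>2 \<le> (1 - b)\<^sup>2 * (norm (Gx x y - w))\<^sup>2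
        + (1 - a)\<^sup>2 * (norm (Gy x y - v))\<^sup>2
        + 8 * Lf\<^sup>2 * ((norm (x' - x))\<^sup>2 + (norm (y' - y))\<^sup>2) + 2 * (a\<^sup>2 + b\<^sup>2) * \<sigma>\<^sup>2"
      by (simp add: px_def py_def)
  qed
  finally show ?thesis .
qed

definition noise where "noise n = 2 * \<gamma> * (c1\<^sup>2 + c2\<^sup>2) * \<sigma>\<^sup>2 * (\<eta> (Suc n)) ^ 3"

lemma noise_nonneg: "0 \<le> noise n"
  unfolding noise_def using gam_pos eta_pos[of "Suc n"] by simp

lemma lyap_expected_step:
  "(\<integral>\<^sup>+\<xi>. ennreal (lyap (Suc n) (next_state n z \<xi>)) \<partial>D) + ennreal (dissipation n z)
    \<le> ennreal (lyap n z) + ennreal (noise n)"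
proof (cases z)
  case (fields x y v w)
  define e where "e = \<eta> (Suc n)"
  define a where "a = \<alpha> (Suc (Suc n))"
  define b where "b = \<beta> (Suc (Suc n))"
  define x' where "x' = x - (\<gamma> * e) *\<^sub>R w"
  define y' where "y' = y + (lam * e) *\<^sub>R v"
  define ex where "ex = (norm (Gx x y - w))\<^sup>2"
  define ey where "ey = (norm (Gy x y - v))\<^sup>2"
  define W where "W = (norm w)\<^sup>2"
  define V where "V = (norm v)\<^sup>2"
  \<comment> \<open>The new point is determined by the old state, so this part is constant in the
    fresh sample; all randomness sits in \<open>N\<close>.\<close>
  define base where "base = F x' - Fstar + A * (F x' - f x' y')"
  define N where "N \<xi> = (norm (Gx x' y' - (gx \<xi> x' y' + (1 - b) *\<^sub>R (w - gx \<xi> x y))))\<^sup>2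
      + (norm (Gy x' y' - (gy \<xi> x' y' + (1 - a) *\<^sub>R (v - gy \<xi> x y))))\<^sup>2" for \<xi>
  define R where "R = (1 - b)\<^sup>2 * ex + (1 - a)\<^sup>2 * ey
      + 8 * Lf\<^sup>2 * ((norm (x' - x))\<^sup>2 + (norm (y' - y))\<^sup>2) + 2 * (a\<^sup>2 + b\<^sup>2) * \<sigma>\<^sup>2"
  have [measurable]: "(\<lambda>\<xi>. gx \<xi> x y) \<in> borel_measurable D" "(\<lambda>\<xi>. gy \<xi> x y) \<in> borel_measurable D" for x y
    using gx_int gy_int by auto
  have N_meas[measurable]: "N \<in> borel_measurable D" unfolding N_def by measurable
  have e: "e > 0" unfolding e_def by (rule eta_pos)
  have base: "0 \<le> base"
    unfolding base_def using Fstar_le[of x'] f_le_F[of x' y'] A_pos by simp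
  have nn: "0 \<le> ex" "0 \<le> ey" "0 \<le> R" "\<And>\<xi>. 0 \<le> N \<xi>"
    by (auto simp: ex_def ey_def R_def N_def)
  have "lyap (Suc n) (next_state n z \<xi>) = base + \<gamma> / e * N \<xi>" for \<xi>
    by (simp add: fields Let_def base_def N_def e_def a_def b_def x'_def y'_def)
  then have "(\<integral>\<^sup>+\<xi>. ennreal (lyap (Suc n) (next_state n z \<xi>)) \<partial>D)
      = (\<integral>\<^sup>+\<xi>. ennreal base + ennreal (\<gamma> / e) * ennreal (N \<xi>) \<partial>D)"
    using base nn e gam_pos by (simp add: ennreal_plus ennreal_mult[symmetric])
  also have "\<dots> = ennreal base + ennreal (\<gamma> / e) * (\<integral>\<^sup>+\<xi>. ennreal (N \<xi>) \<partial>D)"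
    by (subst nn_integral_add) (auto simp: nn_integral_cmult emeasure_space_1)
  also have "\<dots> \<le> ennreal base + ennreal (\<gamma> / e) * ennreal R"
    unfolding N_def R_def ex_def ey_def a_def b_def
    by (intro add_left_mono mult_left_mono expected_error_bound alpha_bounds beta_bounds) auto
  also have "\<dots> = ennreal (base + \<gamma> / e * R)"
    using base nn e gam_pos by (simp add: ennreal_plus ennreal_mult[symmetric])
  finally have "(\<integral>\<^sup>+\<xi>. ennreal (lyap (Suc n) (next_state n z \<xi>)) \<partial>D) + ennreal (dissipation n z)
      \<le> ennreal (base + \<gamma> / e * R) + ennreal (dissipation n z)"
    by (rule add_right_mono)
  also have "\<dots> = ennreal (base + \<gamma> / e * R + dissipation n z)"
    using base nn e gam_pos dissipation_nonneg[of n z] by (simp add: ennreal_plus)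
  also have "\<dots> \<le> ennreal (lyap n z + noise n)"
  proof (rule ennreal_leI)
    have dx: "(norm (x' - x))\<^sup>2 = e\<^sup>2 * (\<gamma>\<^sup>2 * W)" and dy: "(norm (y' - y))\<^sup>2 = e\<^sup>2 * (lam\<^sup>2 * V)"
      by (simp_all add: x'_def y'_def W_def V_def power_mult_distrib)
    have ab: "a = c1 * e\<^sup>2" "b = c2 * e\<^sup>2" by (simp_all add: a_def b_def e_def alpha beta)
    \<comment> \<open>The balance is stated over real atoms so that it is purely linear. The error
      \<open>r\<close> of \<open>w\<close> is released with weight 9/4; the deterministic step
      spends 1 of it and the dissipation 1/4.\<close>
    have combine: "Fp - Fs + AD + gR + dis \<le> ly + nz"
      if "gR = t1 + t2 + t3 + nz" "t1 \<le> p1 - 9 / 4 * r" "t2 \<le> p2 - q"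
        "Fp + AD + t3 + d \<le> Fx + Ax + r + q" "dis = d + 1 / 4 * r" "ly = Fx - Fs + Ax + p1 + p2" "0 \<le> r"
      for Fp Fs AD gR dis ly nz t1 t2 t3 p1 p2 q r d Fx Ax :: real
      using that by linarith
    have nz: "\<gamma> / e * (2 * (a\<^sup>2 + b\<^sup>2) * \<sigma>\<^sup>2) = noise n"
      using e by (simp add: noise_def ab e_def[symmetric] field_simps power2_eq_square power3_eq_cube)
    have 1: "\<gamma> / e * R = \<gamma> * ((1 - b)\<^sup>2 / e) * ex + \<gamma> * ((1 - a)\<^sup>2 / e) * ey
        + 8 * \<gamma> * e * Lf\<^sup>2 * (\<gamma>\<^sup>2 * W + lam\<^sup>2 * V) + noise n"
      unfolding R_def dx dy nz[symmetric] using e by (simp add: field_simps power2_eq_square)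
    have "\<gamma> * ((1 - b)\<^sup>2 / e) * ex \<le> \<gamma> * (1 / \<eta> n - 9 / 4 * e) * ex"
      using momentum_contraction[OF c2_ge, of n] beta_bounds[of "Suc n"] c_pos gam_pos nn
      unfolding ab e_def beta by (intro mult_right_mono mult_left_mono) auto
    then have 2: "\<gamma> * ((1 - b)\<^sup>2 / e) * ex \<le> \<gamma> * (1 / \<eta> n) * ex - 9 / 4 * (\<gamma> * e * ex)"
      by (simp add: right_diff_distrib left_diff_distrib)
    have "\<gamma> * ((1 - a)\<^sup>2 / e) * ey \<le> \<gamma> * (1 / \<eta> n - 9 * Lf\<^sup>2 / \<mu>\<^sup>2 * e) * ey"
      using momentum_contraction[OF c1_ge, of n] alpha_bounds[of "Suc n"] c_pos gam_pos nn
      unfolding ab e_def alpha by (intro mult_right_mono mult_left_mono) auto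
    then have 3: "\<gamma> * ((1 - a)\<^sup>2 / e) * ey \<le> \<gamma> * (1 / \<eta> n) * ey - 9 * Lf\<^sup>2 / \<mu>\<^sup>2 * (\<gamma> * e) * ey"
      by (simp add: right_diff_distrib left_diff_distrib ac_simps)
    have 4: "F x' + A * (F x' - f x' y') + 8 * \<gamma> * e * Lf\<^sup>2 * (\<gamma>\<^sup>2 * W + lam\<^sup>2 * V)
        + \<gamma> * e / 4 * (W + 2 * Lf\<^sup>2 / \<mu> * (F x - f x y))
      \<le> F x + A * (F x - f x y) + \<gamma> * e * ex + 9 * Lf\<^sup>2 / \<mu>\<^sup>2 * (\<gamma> * e) * ey"
      unfolding W_def V_def ex_def ey_def
      by (rule lyapunov_step[OF gam_pos lam_pos e eta_le_1[of "Suc n", folded e_def]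
            lam_eta[of "Suc n", folded e_def] lam_sq gam_le x'_def y'_def A_def])
    have 5: "dissipation n z = \<gamma> * e / 4 * (W + 2 * Lf\<^sup>2 / \<mu> * (F x - f x y)) + 1 / 4 * (\<gamma> * e * ex)"
      by (simp add: fields e_def W_def ex_def distrib_left)
    have 6: "lyap n z = F x - Fstar + A * (F x - f x y) + \<gamma> * (1 / \<eta> n) * ex + \<gamma> * (1 / \<eta> n) * ey"
      by (simp add: fields ex_def ey_def distrib_left)
    have 7: "0 \<le> \<gamma> * e * ex" using gam_pos e nn by simp
    show "base + \<gamma> / e * R + dissipation n z \<le> lyap n z + noise n"
      unfolding base_def by (rule combine[OF 1 2 3 4 5 6 7])
  qed
  also have "\<dots> = ennreal (lyap n z) + ennreal (noise n)"
    using lyap_nonneg noise_nonneg by (simp add: ennreal_plus)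
  finally show ?thesis .
qed

section \<open>The run as a random process: adaptedness and measurability\<close>

abbreviation "S \<equiv> stream_space D"

abbreviation "state \<equiv> msgda gx gy \<gamma> lam \<eta> \<alpha> \<beta> x1 y1"

lemma state_Suc: "state s (Suc n) = next_state n (state s n) (s !! Suc n)"
proof -
  obtain x y v w where z: "state s n = (x, y, v, w)" by (metis prod_cases4)
  have "x + \<eta> (Suc n) *\<^sub>R (x - \<gamma> *\<^sub>R w - x) = x - (\<gamma> * \<eta> (Suc n)) *\<^sub>R w"
    "y + \<eta> (Suc n) *\<^sub>R (y + lam *\<^sub>R v - y) = y + (lam * \<eta> (Suc n)) *\<^sub>R v"
    by (simp_all add: mult.commute)
  then show ?thesis by (simp only: msgda.simps z Let_def prod.case next_state.simps)
qed

text \<open>Adaptedness: relative to state \<open>n\<close>, entry \<open>Suc n\<close> of the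
  stream is a fresh sample.\<close>

lemma state_cong: "(\<And>i. i \<le> n \<Longrightarrow> s !! i = s' !! i) \<Longrightarrow> state s n = state s' n"
proof (induction n)
  case (Suc n)
  then have "state s n = state s' n" by simp
  then show ?case using Suc.prems[of "Suc n"] unfolding state_Suc by simp
qed simp

lemma measurable_gx[measurable (raw)]:
  assumes "a \<in> measurable N D" "x \<in> borel_measurable N" "y \<in> borel_measurable N"
  shows "(\<lambda>\<omega>. gx (a \<omega>) (x \<omega>) (y \<omega>)) \<in> borel_measurable N"
proof (rule Caratheodory_measurable_compose2[OF _ _ _ assms])
  show "(\<lambda>\<xi>. gx \<xi> x y) \<in> borel_measurable D" for x y
    using gx_int by (rule borel_measurable_integrable)
  show "continuous_on UNIV (\<lambda>x. gx \<xi> x y)" if "\<xi> \<in> space D" for \<xi> y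
    by (rule continuous_on_UNIV_of_norm_lipschitz) (rule Lx_x[OF that])
  show "continuous_on UNIV (gx \<xi> x)" if "\<xi> \<in> space D" for \<xi> x
    by (rule continuous_on_UNIV_of_norm_lipschitz) (rule Lx_y[OF that])
qed

lemma measurable_gy[measurable (raw)]:
  assumes "a \<in> measurable N D" "x \<in> borel_measurable N" "y \<in> borel_measurable N"
  shows "(\<lambda>\<omega>. gy (a \<omega>) (x \<omega>) (y \<omega>)) \<in> borel_measurable N"
proof (rule Caratheodory_measurable_compose2[OF _ _ _ assms])
  show "(\<lambda>\<xi>. gy \<xi> x y) \<in> borel_measurable D" for x y
    using gy_int by (rule borel_measurable_integrable)
  show "continuous_on UNIV (\<lambda>x. gy \<xi> x y)" if "\<xi> \<in> space D" for \<xi> y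
    by (rule continuous_on_UNIV_of_norm_lipschitz) (rule Ly_x[OF that])
  show "continuous_on UNIV (gy \<xi> x)" if "\<xi> \<in> space D" for \<xi> x
    by (rule continuous_on_UNIV_of_norm_lipschitz) (rule Ly_y[OF that])
qed

text \<open>The first argument plays the role of the sample, and continuity is used only in the
  second.\<close>

lemma measurable_Gx[measurable (raw)]:
  assumes "x \<in> borel_measurable N" "y \<in> borel_measurable N"
  shows "(\<lambda>\<omega>. Gx (x \<omega>) (y \<omega>)) \<in> borel_measurable N"
proof (rule Caratheodory_measurable_compose[OF _ _ assms])
  show "(\<lambda>x. Gx x y) \<in> borel_measurable borel" for y
    by (rule borel_measurable_continuous_onI, rule continuous_on_UNIV_of_norm_lipschitz) (rule Gx_x)
  show "continuous_on UNIV (Gx x)" for x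
    by (rule continuous_on_UNIV_of_norm_lipschitz) (rule Gx_y)
qed

lemma measurable_Gy[measurable (raw)]:
  assumes "x \<in> borel_measurable N" "y \<in> borel_measurable N"
  shows "(\<lambda>\<omega>. Gy (x \<omega>) (y \<omega>)) \<in> borel_measurable N"
proof (rule Caratheodory_measurable_compose[OF _ _ assms])
  show "(\<lambda>x. Gy x y) \<in> borel_measurable borel" for y
    by (rule borel_measurable_continuous_onI, rule continuous_on_UNIV_of_norm_lipschitz) (rule Gy_x)
  show "continuous_on UNIV (Gy x)" for x
    by (rule continuous_on_UNIV_of_norm_lipschitz) (rule Gy_y)
qed

lemma measurable_f[measurable (raw)]:
  assumes "x \<in> borel_measurable N" "y \<in> borel_measurable N"
  shows "(\<lambda>\<omega>. f (x \<omega>) (y \<omega>)) \<in> borel_measurable N"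
proof (rule Caratheodory_measurable_compose[OF _ _ assms])
  show "(\<lambda>x. f x y) \<in> borel_measurable borel" for y
    using df_x by (intro borel_measurable_continuous_onI)
      (meson continuous_at_imp_continuous_on has_derivative_continuous)
  show "continuous_on UNIV (f x)" for x
    using df_y by (meson continuous_at_imp_continuous_on has_derivative_continuous)
qed

lemma measurable_F[measurable]: "F \<in> borel_measurable borel"
  using F_differentiable
  by (intro borel_measurable_continuous_onI) (simp add: continuous_at_imp_continuous_on differentiable_imp_continuous_within)

lemma measurable_lyap[measurable]: "lyap n \<in> borel_measurable borel"
proof -
  \<comment> \<open>Passing to projections lets the pattern-matching equation unfold at a variable
    state.\<close>
  have "lyap n = (\<lambda>z. lyap n (fst z, fst (snd z), fst (snd (snd z)), snd (snd (snd z))))"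
    by simp
  also have "\<dots> \<in> borel_measurable borel"
    unfolding lyap.simps borel_prod[symmetric] by measurable
  finally show ?thesis .
qed

lemma measurable_dissipation[measurable]: "dissipation n \<in> borel_measurable borel"
proof -
  have "dissipation n = (\<lambda>z. dissipation n (fst z, fst (snd z), fst (snd (snd z)), snd (snd (snd z))))"
    by simp
  also have "\<dots> \<in> borel_measurable borel"
    unfolding dissipation.simps borel_prod[symmetric] by measurable
  finally show ?thesis .
qed

lemma measurable_next_state[measurable (raw)]:
  assumes z[measurable]: "z \<in> borel_measurable N" and a[measurable]: "a \<in> measurable N D"
  shows "(\<lambda>\<omega>. next_state n (z \<omega>) (a \<omega>)) \<in> borel_measurable N"
proof -
  have eq: "next_state n (z \<omega>) (a \<omega>) = next_state n (fst (z \<omega>), fst (snd (z \<omega>)), fst (snd (snd (z \<omega>))),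
      snd (snd (snd (z \<omega>)))) (a \<omega>)" for \<omega>
    by simp
  note z' = z[folded borel_prod]
  note [measurable] = measurable_compose[OF z' measurable_fst]
    measurable_compose[OF measurable_compose[OF z' measurable_snd] measurable_fst]
    measurable_compose[OF measurable_compose[OF measurable_compose[OF z' measurable_snd] measurable_snd] measurable_fst]
    measurable_compose[OF measurable_compose[OF measurable_compose[OF z' measurable_snd] measurable_snd] measurable_snd]
  show ?thesis
    unfolding eq next_state.simps Let_def borel_prod[symmetric]
    by (intro measurable_Pair) measurable
qed

lemma measurable_state[measurable]: "(\<lambda>s. state s n) \<in> borel_measurable S"
proof (induction n)
  case 0
  show ?case unfolding msgda.simps borel_prod[symmetric]
    by (intro measurable_Pair) measurable
next
  case (Suc n)
  note [measurable] = Suc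
  show ?case unfolding state_Suc by measurable
qed

section \<open>Telescoping in expectation\<close>

lemma expected_lyap_step:
  "(\<integral>\<^sup>+s. ennreal (lyap (Suc n) (state s (Suc n))) \<partial>S) + (\<integral>\<^sup>+s. ennreal (dissipation n (state s n)) \<partial>S)
    \<le> (\<integral>\<^sup>+s. ennreal (lyap n (state s n)) \<partial>S) + ennreal (noise n)"
proof -
  interpret S: prob_space S by (rule prob_space_stream_space)
  \<comment> \<open>The fresh sample as a separate argument: \<open>state s n\<close> reads entries
    up to \<open>n\<close>, so entry \<open>Suc n\<close> can be averaged out.\<close>
  define h where "h s \<xi> = ennreal (lyap (Suc n) (next_state n (state s n) \<xi>))" for s \<xi>
  have h[measurable]: "case_prod h \<in> borel_measurable (S \<Otimes>\<^sub>M D)"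
    unfolding h_def by measurable
  have "(\<integral>\<^sup>+s. ennreal (lyap (Suc n) (state s (Suc n))) \<partial>S) = (\<integral>\<^sup>+s. h s (s !! Suc n) \<partial>S)"
    by (simp only: state_Suc h_def)
  also have "\<dots> = (\<integral>\<^sup>+s. \<integral>\<^sup>+\<xi>. h s \<xi> \<partial>D \<partial>S)"
  proof (rule nn_integral_stream_space_snth[OF h])
    fix s s' :: "'a stream" assume "\<And>i. i < Suc n \<Longrightarrow> s !! i = s' !! i"
    then have "state s n = state s' n" by (intro state_cong) simp
    then show "h s = h s'" by (simp add: h_def fun_eq_iff)
  qed
  finally have "(\<integral>\<^sup>+s. ennreal (lyap (Suc n) (state s (Suc n))) \<partial>S) + (\<integral>\<^sup>+s. ennreal (dissipation n (state s n)) \<partial>S)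
      = (\<integral>\<^sup>+s. (\<integral>\<^sup>+\<xi>. h s \<xi> \<partial>D) + ennreal (dissipation n (state s n)) \<partial>S)"
    by (simp add: nn_integral_add)
  also have "\<dots> \<le> (\<integral>\<^sup>+s. ennreal (lyap n (state s n)) + ennreal (noise n) \<partial>S)"
    unfolding h_def by (intro nn_integral_mono lyap_expected_step)
  also have "\<dots> = (\<integral>\<^sup>+s. ennreal (lyap n (state s n)) \<partial>S) + ennreal (noise n)"
    by (simp add: nn_integral_add S.emeasure_space_1)
  finally show ?thesis .
qed

text \<open>Without subtraction, the last Lyapunov term stays on the left and is discarded by its
  user.\<close>

lemma telescoped_dissipation:
  "(\<integral>\<^sup>+s. ennreal (lyap T (state s T)) \<partial>S) + (\<Sum>n<T. \<integral>\<^sup>+s. ennreal (dissipation n (state s n)) \<partial>S)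
    \<le> (\<integral>\<^sup>+s. ennreal (lyap 0 (state s 0)) \<partial>S) + ennreal (\<Sum>n<T. noise n)"
proof (induction T)
  case (Suc T)
  let ?E = "\<lambda>n. \<integral>\<^sup>+s. ennreal (lyap n (state s n)) \<partial>S" and ?D = "\<lambda>n. \<integral>\<^sup>+s. ennreal (dissipation n (state s n)) \<partial>S"
  have "?E (Suc T) + (\<Sum>n<Suc T. ?D n) = (?E (Suc T) + ?D T) + (\<Sum>n<T. ?D n)"
    by (simp only: sum.lessThan_Suc ac_simps)
  also have "\<dots> \<le> (?E T + ennreal (noise T)) + (\<Sum>n<T. ?D n)"
    by (intro add_right_mono expected_lyap_step)
  also have "\<dots> = (?E T + (\<Sum>n<T. ?D n)) + ennreal (noise T)" by (simp only: ac_simps)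
  also have "\<dots> \<le> (?E 0 + ennreal (\<Sum>n<T. noise n)) + ennreal (noise T)"
    by (intro add_right_mono Suc.IH)
  also have "\<dots> = ?E 0 + ennreal (\<Sum>n<Suc T. noise n)"
    by (simp add: add.assoc ennreal_plus[symmetric] noise_nonneg sum_nonneg del: ennreal_plus)
  finally show ?case .
qed simp

text \<open>The first estimators are plain sample gradients at a deterministic point, so the
  variance bound applies directly; the averaging lemma is used with n = 0 and a function that
  ignores the stream.\<close>

lemma expected_initial_lyap:
  "(\<integral>\<^sup>+s. ennreal (lyap 0 (state s 0)) \<partial>S)
    \<le> ennreal (F x1 - Fstar + A * (F x1 - f x1 y1) + \<gamma> / \<eta> 0 * \<sigma>\<^sup>2)"
proof -
  define base where "base = F x1 - Fstar + A * (F x1 - f x1 y1)"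
  define N where "N \<xi> = (norm (Gx x1 y1 - gx \<xi> x1 y1))\<^sup>2 + (norm (Gy x1 y1 - gy \<xi> x1 y1))\<^sup>2" for \<xi>
  have [measurable]: "N \<in> borel_measurable D" unfolding N_def by measurable
  have base: "0 \<le> base"
    unfolding base_def using Fstar_le[of x1] f_le_F[of x1 y1] A_pos by simp
  have g: "0 \<le> \<gamma> / \<eta> 0" using gam_pos eta_pos[of 0] by simp
  have N: "0 \<le> N \<xi>" for \<xi> by (simp add: N_def)
  have eq: "ennreal (lyap 0 (state s 0)) = ennreal base + ennreal (\<gamma> / \<eta> 0) * ennreal (N (s !! 0))" for s
  proof -
    have "lyap 0 (state s 0) = base + \<gamma> / \<eta> 0 * N (s !! 0)" by (simp add: base_def N_def)
    then show ?thesis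
      unfolding ennreal_mult[OF g N, symmetric]
      using ennreal_plus[OF base mult_nonneg_nonneg[OF g N]] by simp
  qed
  have "(\<integral>\<^sup>+s. ennreal (lyap 0 (state s 0)) \<partial>S)
      = (\<integral>\<^sup>+s. (\<lambda>_ \<xi>. ennreal base + ennreal (\<gamma> / \<eta> 0) * ennreal (N \<xi>)) s (s !! 0) \<partial>S)"
    unfolding eq ..
  also have "\<dots> = (\<integral>\<^sup>+s. \<integral>\<^sup>+\<xi>. ennreal base + ennreal (\<gamma> / \<eta> 0) * ennreal (N \<xi>) \<partial>D \<partial>S)"
    by (rule nn_integral_stream_space_snth) auto
  also have "\<dots> = (\<integral>\<^sup>+\<xi>. ennreal base + ennreal (\<gamma> / \<eta> 0) * ennreal (N \<xi>) \<partial>D)"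
    by (simp add: prob_space.emeasure_space_1[OF prob_space_stream_space])
  also have "\<dots> = ennreal base + ennreal (\<gamma> / \<eta> 0) * (\<integral>\<^sup>+\<xi>. ennreal (N \<xi>) \<partial>D)"
    by (subst nn_integral_add) (auto simp: nn_integral_cmult emeasure_space_1)
  also have "\<dots> \<le> ennreal base + ennreal (\<gamma> / \<eta> 0) * ennreal (\<sigma>\<^sup>2)"
    unfolding N_def by (intro add_left_mono mult_left_mono variance) auto
  also have "\<dots> = ennreal (base + \<gamma> / \<eta> 0 * \<sigma>\<^sup>2)"
    unfolding ennreal_mult[OF g zero_le_power2, symmetric]
    by (rule ennreal_plus[OF base mult_nonneg_nonneg[OF g zero_le_power2], symmetric])
  finally show ?thesis by (simp add: base_def)
qed

text \<open>Cubing the step size removes the cube root and leaves a harmonic sum, the source of the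
  logarithm in \<open>H\<close>.\<close>

lemma sum_noise_le: "(\<Sum>n<T. noise n) \<le> 2 * \<gamma> * (c1\<^sup>2 + c2\<^sup>2) * \<sigma>\<^sup>2 * (k ^ 3 * ln (m + real T))"
proof -
  have "(\<eta> (Suc n)) ^ 3 = k ^ 3 * (1 / (m + real (Suc n)))" for n
    using m_ge(1) cube_root_pow[of "m + real (Suc n)"] by (simp add: eta power_divide)
  then have "(\<Sum>n<T. noise n) = 2 * \<gamma> * (c1\<^sup>2 + c2\<^sup>2) * \<sigma>\<^sup>2 * (k ^ 3 * (\<Sum>n<T. 1 / (m + real (Suc n))))"
    by (simp only: noise_def sum_distrib_left)
  also have "\<dots> \<le> 2 * \<gamma> * (c1\<^sup>2 + c2\<^sup>2) * \<sigma>\<^sup>2 * (k ^ 3 * ln (m + real T))"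
    using gam_pos k_pos m_ge(1) by (intro mult_left_mono sum_inverse_le_ln) auto
  finally show ?thesis .
qed

definition H where
  "H T = (F x1 - Fstar) / (\<gamma> * k) + 9 * Lf\<^sup>2 / (k * lam * \<mu>\<^sup>2) * (F x1 - f x1 y1)
    + 2 * \<sigma>\<^sup>2 * m powr (1/3) / k\<^sup>2 + 2 * k\<^sup>2 * (c1\<^sup>2 + c2\<^sup>2) * \<sigma>\<^sup>2 * ln (m + real T)"

lemma H_nonneg: "0 \<le> H T"
  unfolding H_def using Fstar_le[of x1] f_le_F[of x1 y1] gam_pos k_pos lam_pos m_ge(1)
  by (intro add_nonneg_nonneg mult_nonneg_nonneg divide_nonneg_nonneg) auto

lemma expected_dissipation_sum:
  "(\<Sum>n<T. \<integral>\<^sup>+s. ennreal (dissipation n (state s n)) \<partial>S) \<le> ennreal (\<gamma> * k * H T)"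
proof -
  have "(\<Sum>n<T. \<integral>\<^sup>+s. ennreal (dissipation n (state s n)) \<partial>S)
      \<le> (\<integral>\<^sup>+s. ennreal (lyap T (state s T)) \<partial>S) + (\<Sum>n<T. \<integral>\<^sup>+s. ennreal (dissipation n (state s n)) \<partial>S)"
    by simp
  also have "\<dots> \<le> (\<integral>\<^sup>+s. ennreal (lyap 0 (state s 0)) \<partial>S) + ennreal (\<Sum>n<T. noise n)"
    by (rule telescoped_dissipation)
  also have "\<dots> \<le> ennreal (F x1 - Fstar + A * (F x1 - f x1 y1) + \<gamma> / \<eta> 0 * \<sigma>\<^sup>2) + ennreal (\<Sum>n<T. noise n)"
    by (rule add_right_mono) (rule expected_initial_lyap)
  also have "\<dots> = ennreal (F x1 - Fstar + A * (F x1 - f x1 y1) + \<gamma> / \<eta> 0 * \<sigma>\<^sup>2 + (\<Sum>n<T. noise n))"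
    using Fstar_le[of x1] f_le_F[of x1 y1] A_pos gam_pos eta_pos[of 0]
    by (intro ennreal_plus[symmetric] add_nonneg_nonneg sum_nonneg noise_nonneg) auto
  also have "\<dots> \<le> ennreal (\<gamma> * k * H T)"
  proof (rule ennreal_leI)
    have "\<gamma> / \<eta> 0 * \<sigma>\<^sup>2 \<le> \<gamma> * k * (2 * \<sigma>\<^sup>2 * m powr (1/3) / k\<^sup>2)"
    proof -
      have "\<gamma> / \<eta> 0 * \<sigma>\<^sup>2 = \<gamma> * \<sigma>\<^sup>2 * m powr (1/3) / k" by (simp add: eta)
      \<comment> \<open>The joint variance bound covers both initial errors with one
        \<open>\<sigma>\<^sup>2\<close>, while \<open>H\<close> provides two.\<close>
      also have "\<dots> \<le> 2 * (\<gamma> * \<sigma>\<^sup>2 * m powr (1/3) / k)"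
      proof -
        have "0 \<le> \<gamma> * \<sigma>\<^sup>2 * m powr (1/3) / k" using gam_pos k_pos by simp
        then show ?thesis by linarith
      qed
      also have "\<dots> = \<gamma> * k * (2 * \<sigma>\<^sup>2 * m powr (1/3) / k\<^sup>2)"
        using k_pos by (simp add: power2_eq_square)
      finally show ?thesis .
    qed
    moreover have "F x1 - Fstar = \<gamma> * k * ((F x1 - Fstar) / (\<gamma> * k))"
      using gam_pos k_pos by simp
    moreover have "A * (F x1 - f x1 y1) = \<gamma> * k * (9 * Lf\<^sup>2 / (k * lam * \<mu>\<^sup>2) * (F x1 - f x1 y1))"
      using k_pos by (simp add: A_def)
    moreover have "2 * \<gamma> * (c1\<^sup>2 + c2\<^sup>2) * \<sigma>\<^sup>2 * (k ^ 3 * ln (m + real T))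
        = \<gamma> * k * (2 * k\<^sup>2 * (c1\<^sup>2 + c2\<^sup>2) * \<sigma>\<^sup>2 * ln (m + real T))"
      by (simp add: power2_eq_square power3_eq_cube)
    ultimately show "F x1 - Fstar + A * (F x1 - f x1 y1) + \<gamma> / \<eta> 0 * \<sigma>\<^sup>2 + (\<Sum>n<T. noise n) \<le> \<gamma> * k * H T"
      using sum_noise_le[of T] unfolding H_def distrib_left by linarith
  qed
  finally show ?thesis .
qed

section \<open>From dissipation to the metric and its rate\<close>

fun gap :: "'x \<times> 'y \<times> 'y \<times> 'x \<Rightarrow> real" where
  "gap (x, y, v, w) = norm w + sqrt 2 * Lf / sqrt \<mu> * sqrt (F x - f x y) + norm (Gx x y - w)"

text \<open>Triangle inequality along \<open>grad F x\<close>, \<open>Gx x y\<close>,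
  \<open>w\<close>, 0; the first leg is controlled by the gap of \<open>f\<close>.\<close>

lemma grad_F_le_gap: "norm (grad F x) \<le> gap (x, y, v, w)"
proof -
  have "norm (grad F x - Gx x y) \<le> sqrt (2 * Lf\<^sup>2 / \<mu> * (F x - f x y))"
    by (rule real_le_rsqrt) (rule grad_F_gap)
  also have "\<dots> = sqrt 2 * Lf / sqrt \<mu> * sqrt (F x - f x y)"
    using Lf_pos by (simp add: real_sqrt_mult real_sqrt_divide)
  finally have 1: "norm (grad F x - Gx x y) \<le> \<dots>" .
  have "norm (grad F x) \<le> norm w + norm (grad F x - Gx x y) + norm (Gx x y - w)"
    using norm_triangle_ineq[of "grad F x - Gx x y" "Gx x y"] norm_triangle_ineq[of "Gx x y - w" w] by simp
  with 1 show ?thesis by simp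
qed

text \<open>Young's inequality with a free \<open>c\<close> makes the bound linear in the
  dissipation, so expectations can be taken before \<open>c\<close> is chosen. The factor 6 is half
  of 3 times 4: three squared summands, and the quarter in \<open>dissipation\<close>. Monotone step
  sizes allow \<open>\<eta> T\<close> for every earlier step.\<close>

lemma gap_le:
  assumes c: "c > 0" and n: "n < T"
  shows "gap z \<le> 6 / (\<gamma> * \<eta> T * c) * dissipation n z + c / 2"
proof (cases z)
  case (fields x y v w)
  define p where "p = norm w"
  define q where "q = sqrt 2 * Lf / sqrt \<mu> * sqrt (F x - f x y)"
  define r where "r = norm (Gx x y - w)"
  have q2: "q\<^sup>2 = 2 * Lf\<^sup>2 / \<mu> * (F x - f x y)"
    using mu_pos f_le_F[of x y] by (simp add: q_def power_mult_distrib power_divide)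
  have "0 \<le> (p - q)\<^sup>2 + (q - r)\<^sup>2 + (p - r)\<^sup>2" by simp
  then have "(p + q + r)\<^sup>2 \<le> 3 * (p\<^sup>2 + q\<^sup>2 + r\<^sup>2)"
    by (simp add: power2_eq_square algebra_simps)
  also have "\<dots> = 12 / (\<gamma> * \<eta> (Suc n)) * dissipation n z"
    using gam_pos eta_pos[of "Suc n"] unfolding fields dissipation.simps p_def r_def q2
    by (simp add: field_simps)
  also have "\<dots> \<le> 12 / (\<gamma> * \<eta> T) * dissipation n z"
    using gam_pos eta_pos eta_antimono[of "Suc n" T] n dissipation_nonneg[of n z]
    by (intro mult_right_mono divide_left_mono mult_left_mono mult_pos_pos) auto
  finally have sq: "(p + q + r)\<^sup>2 \<le> 12 / (\<gamma> * \<eta> T) * dissipation n z" .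
  have "0 \<le> (p + q + r - c)\<^sup>2" by simp
  then have "2 * c * (p + q + r) \<le> (p + q + r)\<^sup>2 + c\<^sup>2"
    by (simp add: power2_eq_square algebra_simps)
  then have "p + q + r \<le> (p + q + r)\<^sup>2 / (2 * c) + c / 2"
    using c by (simp add: field_simps power2_eq_square)
  also have "\<dots> \<le> 12 / (\<gamma> * \<eta> T) * dissipation n z / (2 * c) + c / 2"
    using sq c by (intro add_right_mono divide_right_mono) auto
  also have "12 / (\<gamma> * \<eta> T) * dissipation n z / (2 * c) = 6 / (\<gamma> * \<eta> T * c) * dissipation n z"
    by simp
  also have "p + q + r = gap z" by (simp add: fields p_def q_def r_def)
  finally show ?thesis .
qed

text \<open>Jensen and Cauchy-Schwarz at once: \<open>c\<close> is common to all steps and is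
  optimised only after summing. The factor \<open>k\<close> in \<open>\<eta> T\<close> cancels
  against the one in the dissipation bound.\<close>

lemma expected_gap_sum:
  assumes T: "T \<ge> 1"
  shows "(\<Sum>n<T. \<integral>\<^sup>+s. ennreal (gap (state s n)) \<partial>S)
    \<le> ennreal (sqrt (12 * H T * (m + real T) powr (1/3) * real T))"
proof (rule le_ennreal_sqrt_of_AM_GM)
  interpret S: prob_space S by (rule prob_space_stream_space)
  show "0 \<le> 12 * H T * (m + real T) powr (1/3)" using H_nonneg[of T] by simp
  show "0 < real T" using T by simp
  fix c :: real assume c: "c > 0"
  define a where "a = 6 / (\<gamma> * \<eta> T * c)"
  have a: "0 \<le> a" using gam_pos eta_pos[of T] c by (simp add: a_def)
  have "(\<Sum>n<T. \<integral>\<^sup>+s. ennreal (gap (state s n)) \<partial>S)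
      \<le> (\<Sum>n<T. \<integral>\<^sup>+s. ennreal a * ennreal (dissipation n (state s n)) + ennreal (c / 2) \<partial>S)"
  proof (intro sum_mono nn_integral_mono)
    fix n s assume "n \<in> {..<T}"
    then have "gap (state s n) \<le> a * dissipation n (state s n) + c / 2"
      using gap_le[OF c] by (simp add: a_def)
    then show "ennreal (gap (state s n)) \<le> ennreal a * ennreal (dissipation n (state s n)) + ennreal (c / 2)"
      using a c dissipation_nonneg[of n "state s n"]
      by (simp add: ennreal_mult[symmetric] ennreal_plus[symmetric] ennreal_leI del: ennreal_plus)
  qed
  also have "\<dots> = ennreal a * (\<Sum>n<T. \<integral>\<^sup>+s. ennreal (dissipation n (state s n)) \<partial>S) + of_nat T * ennreal (c / 2)"
    by (simp add: nn_integral_add nn_integral_cmult S.emeasure_space_1 sum.distrib sum_distrib_left)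
  also have "\<dots> \<le> ennreal a * ennreal (\<gamma> * k * H T) + of_nat T * ennreal (c / 2)"
    by (intro add_right_mono mult_left_mono expected_dissipation_sum) auto
  also have "\<dots> = ennreal (a * (\<gamma> * k * H T) + real T * (c / 2))"
    using a c gam_pos k_pos H_nonneg[of T]
    by (simp add: ennreal_mult[symmetric] ennreal_plus[symmetric] ennreal_of_nat_eq_real_of_nat del: ennreal_plus)
  also have "a * (\<gamma> * k * H T) = 12 * H T * (m + real T) powr (1/3) / (2 * c)"
    using gam_pos k_pos m_ge(1) by (simp add: a_def eta)
  finally show "(\<Sum>n<T. \<integral>\<^sup>+s. ennreal (gap (state s n)) \<partial>S)
      \<le> ennreal (12 * H T * (m + real T) powr (1/3) / (2 * c) + real T * c / 2)" by simp
qed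

text \<open>Subadditivity of the sixth root separates \<open>m\<close> from \<open>T\<close>, which
  produces the two powers of \<open>T\<close>.\<close>

lemma rate_bound:
  assumes T: "T \<ge> 1"
  shows "1 / real T * sqrt (12 * H T * (m + real T) powr (1/3) * real T)
    \<le> 2 * sqrt (3 * H T) * m powr (1/6) / real T powr (1/2) + 2 * sqrt (3 * H T) / real T powr (1/3)"
proof -
  have T0: "real T > 0" and m0: "m > 0" using T m_ge(1) by auto
  have "sqrt ((m + real T) powr (1/3)) = (m + real T) powr (1/6)"
    using T0 m0 by (simp add: powr_half_sqrt[symmetric] powr_powr)
  moreover have "12 * H T = 2\<^sup>2 * (3 * H T)" by simp
  ultimately have "sqrt (12 * H T * (m + real T) powr (1/3) * real T)
      = 2 * sqrt (3 * H T) * (m + real T) powr (1/6) * sqrt (real T)"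
    by (simp only: real_sqrt_mult real_sqrt_abs abs_numeral)
  then have "1 / real T * sqrt (12 * H T * (m + real T) powr (1/3) * real T)
      = 2 * sqrt (3 * H T) * (m + real T) powr (1/6) * (sqrt (real T) / real T)"
    by simp
  also have "sqrt (real T) / real T = 1 / real T powr (1/2)"
    using T0 by (simp add: powr_half_sqrt real_div_sqrt field_simps)
  also have "2 * sqrt (3 * H T) * (m + real T) powr (1/6) * (1 / real T powr (1/2))
      \<le> 2 * sqrt (3 * H T) * (m powr (1/6) + real T powr (1/6)) * (1 / real T powr (1/2))"
    using H_nonneg[of T] T0 m0 by (intro mult_right_mono mult_left_mono powr_sixth_add_le) auto
  also have "\<dots> = 2 * sqrt (3 * H T) * m powr (1/6) / real T powr (1/2)
      + 2 * sqrt (3 * H T) * (real T powr (1/6) / real T powr (1/2))"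
    by (simp add: distrib_left distrib_right add_divide_distrib)
  also have "real T powr (1/6) / real T powr (1/2) = 1 / real T powr (1/3)"
    using T0 by (simp add: powr_diff[symmetric] powr_minus_divide[symmetric])
  finally show ?thesis by simp
qed

end

text \<open>The stream space is the law of the i.i.d. samples. Since expectations are nonnegative
  integrals, the real right-hand side also asserts that they are finite. Differentiability of
  \<open>F\<close> belongs to the conclusion because \<open>grad\<close> describes a gradient only
  where the derivative exists.\<close>

theorem theorem1:
  fixes D :: "'a measure"
    and fs :: "'a \<Rightarrow> 'x::euclidean_space \<Rightarrow> 'y::euclidean_space \<Rightarrow> real"
    and gx :: "'a \<Rightarrow> 'x \<Rightarrow> 'y \<Rightarrow> 'x" and gy :: "'a \<Rightarrow> 'x \<Rightarrow> 'y \<Rightarrow> 'y"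
    and f :: "'x \<Rightarrow> 'y \<Rightarrow> real" and Gx :: "'x \<Rightarrow> 'y \<Rightarrow> 'x" and Gy :: "'x \<Rightarrow> 'y \<Rightarrow> 'y"
    and \<mu> Lf \<sigma> k m c1 c2 lam \<gamma> :: real
    and \<eta> \<alpha> \<beta> :: "nat \<Rightarrow> real"
    and x1 :: 'x and y1 :: 'y and T :: nat
  assumes D: "prob_space D"
    \<comment> \<open>stochastic components: partial gradients of f(.,.;xi)\<close>
    and dfs_x: "\<And>\<xi> x y. \<xi> \<in> space D \<Longrightarrow> ((\<lambda>x'. fs \<xi> x' y) has_derivative (\<lambda>h. gx \<xi> x y \<bullet> h)) (at x)"
    and dfs_y: "\<And>\<xi> x y. \<xi> \<in> space D \<Longrightarrow> ((\<lambda>y'. fs \<xi> x y') has_derivative (\<lambda>h. gy \<xi> x y \<bullet> h)) (at y)"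
    \<comment> \<open>f = E[f(.,.;xi)] and its partial gradients\<close>
    and fs_int: "\<And>x y. integrable D (\<lambda>\<xi>. fs \<xi> x y)"
    and f_def: "\<And>x y. f x y = (\<integral>\<xi>. fs \<xi> x y \<partial>D)"
    and df_x: "\<And>x y. ((\<lambda>x'. f x' y) has_derivative (\<lambda>h. Gx x y \<bullet> h)) (at x)"
    and df_y: "\<And>x y. ((\<lambda>y'. f x y') has_derivative (\<lambda>h. Gy x y \<bullet> h)) (at y)"
    \<comment> \<open>(A1)\<close>
    and mu_pos: "\<mu> > 0"
    and argmax_ne: "\<And>x. \<exists>y. \<forall>y'. f x y' \<le> f x y"
    and PL: "\<And>x y. (norm (Gy x y))\<^sup>2 \<ge> 2 * \<mu> * (Fmax f x - f x y)"
    \<comment> \<open>(A2)\<close>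
    and Lf_pos: "Lf > 0"
    and Lx_x: "\<And>\<xi> x1' x2' y. \<xi> \<in> space D \<Longrightarrow> norm (gx \<xi> x1' y - gx \<xi> x2' y) \<le> Lf * norm (x1' - x2')"
    and Lx_y: "\<And>\<xi> x y1' y2'. \<xi> \<in> space D \<Longrightarrow> norm (gx \<xi> x y1' - gx \<xi> x y2') \<le> Lf * norm (y1' - y2')"
    and Ly_x: "\<And>\<xi> x1' x2' y. \<xi> \<in> space D \<Longrightarrow> norm (gy \<xi> x1' y - gy \<xi> x2' y) \<le> Lf * norm (x1' - x2')"
    and Ly_y: "\<And>\<xi> x y1' y2'. \<xi> \<in> space D \<Longrightarrow> norm (gy \<xi> x y1' - gy \<xi> x y2') \<le> Lf * norm (y1' - y2')"
    \<comment> \<open>(A3)\<close>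
    and gx_int: "\<And>x y. integrable D (\<lambda>\<xi>. gx \<xi> x y)"
    and gy_int: "\<And>x y. integrable D (\<lambda>\<xi>. gy \<xi> x y)"
    and unbiased_x: "\<And>x y. (\<integral>\<xi>. gx \<xi> x y \<partial>D) = Gx x y"
    and unbiased_y: "\<And>x y. (\<integral>\<xi>. gy \<xi> x y \<partial>D) = Gy x y"
    and variance: "\<And>x y. (\<integral>\<^sup>+\<xi>. ennreal ((norm (Gx x y - gx \<xi> x y))\<^sup>2 + (norm (Gy x y - gy \<xi> x y))\<^sup>2) \<partial>D)
                         \<le> ennreal (\<sigma>\<^sup>2)"
    \<comment> \<open>(A4)\<close>
    and bdd: "bdd_below (range (Fmax f))"
    \<comment> \<open>step sizes and parameters\<close>
    and eta: "\<And>t. \<eta> t = k / (m + real t) powr (1/3)"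
    and alpha: "\<And>t. \<alpha> (Suc t) = c1 * (\<eta> t)\<^sup>2"
    and beta: "\<And>t. \<beta> (Suc t) = c2 * (\<eta> t)\<^sup>2"
    and k_pos: "k > 0"
    and m_ge: "m \<ge> Max {2, k ^ 3, (c1 * k) ^ 3, (c2 * k) ^ 3}"
    and c1_ge: "c1 \<ge> 2 / (3 * k ^ 3) + 9 * Lf\<^sup>2 / \<mu>\<^sup>2"
    and c2_ge: "c2 \<ge> 2 / (3 * k ^ 3) + 9 / 4"
    and lam_pos: "0 < lam"
    and lam_le: "lam \<le> min (3 / (4 * sqrt 2 * \<mu>)) (m powr (1/3) / (2 * Lf * k))"
    and gam_pos: "0 < \<gamma>"
    and gam_le: "\<gamma> \<le> min (lam * \<mu> / (16 * (Lf * (1 + (Lf / \<mu>) / 2))))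
                        (1 / (2 * Lf * sqrt (8 + 9 / (8 * lam * \<mu>\<^sup>2))))"
    and T_ge: "T \<ge> 1"
  shows
    "let F = Fmax f;
         Fstar = (INF x. F x);
         X = xs gx gy \<gamma> lam \<eta> \<alpha> \<beta> x1 y1;
         Y = ys gx gy \<gamma> lam \<eta> \<alpha> \<beta> x1 y1;
         W = ws gx gy \<gamma> lam \<eta> \<alpha> \<beta> x1 y1;
         G = (\<lambda>s t. (1 / \<gamma>) * norm (X s t - (X s t - \<gamma> *\<^sub>R W s t))
                     + sqrt 2 * Lf / sqrt \<mu> * sqrt (F (X s t) - f (X s t) (Y s t))
                     + norm (Gx (X s t) (Y s t) - W s t));
         \<Delta>1 = F x1 - f x1 y1;
         H = (F x1 - Fstar) / (\<gamma> * k) + 9 * Lf\<^sup>2 / (k * lam * \<mu>\<^sup>2) * \<Delta>1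
             + 2 * \<sigma>\<^sup>2 * m powr (1/3) / k\<^sup>2 + 2 * k\<^sup>2 * (c1\<^sup>2 + c2\<^sup>2) * \<sigma>\<^sup>2 * ln (m + real T);
         S = stream_space D
     in (\<forall>x. F differentiable (at x)) \<and>
        ennreal (1 / real T) * (\<Sum>t=1..T. \<integral>\<^sup>+s. ennreal (norm (grad F (X s t))) \<partial>S)
          \<le> ennreal (1 / real T) * (\<Sum>t=1..T. \<integral>\<^sup>+s. ennreal (G s t) \<partial>S) \<and>
        ennreal (1 / real T) * (\<Sum>t=1..T. \<integral>\<^sup>+s. ennreal (G s t) \<partial>S)
          \<le> ennreal (2 * sqrt (3 * H) * m powr (1/6) / real T powr (1/2) + 2 * sqrt (3 * H) / real T powr (1/3))"
proof -
  interpret P: prob_space D by (rule D)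
  have pl: "pl_minimax f Gx Gy \<mu> Lf"
  proof
    show "norm (Gx x y - Gx x' y) \<le> Lf * norm (x - x')" for x x' y
      unfolding unbiased_x[symmetric] by (intro P.norm_expectation_diff_le gx_int Lx_x)
    show "norm (Gx x y - Gx x y') \<le> Lf * norm (y - y')" for x y y'
      unfolding unbiased_x[symmetric] by (intro P.norm_expectation_diff_le gx_int Lx_y)
    show "norm (Gy x y - Gy x' y) \<le> Lf * norm (x - x')" for x x' y
      unfolding unbiased_y[symmetric] by (intro P.norm_expectation_diff_le gy_int Ly_x)
    show "norm (Gy x y - Gy x y') \<le> Lf * norm (y - y')" for x y y'
      unfolding unbiased_y[symmetric] by (intro P.norm_expectation_diff_le gy_int Ly_y)
  qed (fact df_x df_y mu_pos argmax_ne PL Lf_pos)+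
  have m: "m \<ge> 2" "k ^ 3 \<le> m" "(c1 * k) ^ 3 \<le> m" "(c2 * k) ^ 3 \<le> m"
    using m_ge by simp_all
  have lam_sq: "(lam * \<mu>)\<^sup>2 \<le> 9 / 32"
  proof -
    have "lam * \<mu> \<le> 3 / (4 * sqrt 2)" using lam_le mu_pos by (simp add: field_simps)
    then have "(lam * \<mu>)\<^sup>2 \<le> (3 / (4 * sqrt 2))\<^sup>2"
      using lam_pos mu_pos by (intro power_mono) auto
    then show ?thesis by (simp add: power_divide power_mult_distrib)
  qed
  have gam: "\<gamma> * (Lf * (1 + (Lf / \<mu>) / 2)) \<le> lam * \<mu> / 16"
  proof -
    define L where "L = Lf * (1 + (Lf / \<mu>) / 2)"
    have "L > 0" unfolding L_def using Lf_pos mu_pos by (intro mult_pos_pos add_pos_pos) auto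
    moreover have "\<gamma> \<le> lam * \<mu> / (16 * L)" using gam_le by (simp add: L_def)
    ultimately show ?thesis unfolding L_def[symmetric] by (simp add: field_simps)
  qed
  interpret R: msgda_run f Gx Gy \<mu> Lf D gx gy \<sigma> k m c1 c2 lam \<gamma> \<eta> \<alpha> \<beta> x1 y1
  proof (intro msgda_run.intro msgda_run_axioms.intro pl D)
    show "lam \<le> m powr (1/3) / (2 * Lf * k)" using lam_le by simp
  qed (fact Lx_x Lx_y Ly_x Ly_y gx_int gy_int unbiased_x unbiased_y variance bdd eta alpha beta
      k_pos m c1_ge c2_ge lam_pos lam_sq gam_pos gam)+
  define X where "X = xs gx gy \<gamma> lam \<eta> \<alpha> \<beta> x1 y1"
  define Y where "Y = ys gx gy \<gamma> lam \<eta> \<alpha> \<beta> x1 y1"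
  define W where "W = ws gx gy \<gamma> lam \<eta> \<alpha> \<beta> x1 y1"
  define G where "G s t = (1 / \<gamma>) * norm (X s t - (X s t - \<gamma> *\<^sub>R W s t))
      + sqrt 2 * Lf / sqrt \<mu> * sqrt (Fmax f (X s t) - f (X s t) (Y s t))
      + norm (Gx (X s t) (Y s t) - W s t)" for s t
  \<comment> \<open>Time \<open>Suc n\<close> of the accessors is state \<open>n\<close>, and the
    factor 1/\<gamma> cancels the length of the step \<gamma> w.\<close>
  have G: "G s (Suc n) = R.gap (R.state s n)" and grad: "norm (grad (Fmax f) (X s (Suc n))) \<le> G s (Suc n)" for s n
  proof -
    obtain x y v w where z: "R.state s n = (x, y, v, w)" by (metis prod_cases4)
    have XYW: "X s (Suc n) = x" "Y s (Suc n) = y" "W s (Suc n) = w"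
      by (simp_all add: X_def Y_def W_def xs_def ys_def ws_def z)
    show *: "G s (Suc n) = R.gap (R.state s n)"
      unfolding G_def XYW z R.gap.simps using gam_pos by simp
    show "norm (grad (Fmax f) (X s (Suc n))) \<le> G s (Suc n)"
      unfolding * unfolding z XYW by (rule R.grad_F_le_gap)
  qed
  have "(\<Sum>t=1..T. \<integral>\<^sup>+s. ennreal (norm (grad (Fmax f) (X s t))) \<partial>stream_space D)
      \<le> (\<Sum>t=1..T. \<integral>\<^sup>+s. ennreal (G s t) \<partial>stream_space D)"
    unfolding One_nat_def sum.atLeast1_atMost_eq by (intro sum_mono nn_integral_mono ennreal_leI grad)
  then have 1: "ennreal (1 / real T) * (\<Sum>t=1..T. \<integral>\<^sup>+s. ennreal (norm (grad (Fmax f) (X s t))) \<partial>stream_space D)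
      \<le> ennreal (1 / real T) * (\<Sum>t=1..T. \<integral>\<^sup>+s. ennreal (G s t) \<partial>stream_space D)"
    by (rule mult_left_mono) simp
  have "(\<Sum>t=1..T. \<integral>\<^sup>+s. ennreal (G s t) \<partial>stream_space D)
      \<le> ennreal (sqrt (12 * R.H T * (m + real T) powr (1/3) * real T))"
    unfolding One_nat_def sum.atLeast1_atMost_eq G by (rule R.expected_gap_sum) (rule T_ge)
  then have "ennreal (1 / real T) * (\<Sum>t=1..T. \<integral>\<^sup>+s. ennreal (G s t) \<partial>stream_space D)
      \<le> ennreal (1 / real T) * ennreal (sqrt (12 * R.H T * (m + real T) powr (1/3) * real T))"
    by (rule mult_left_mono) simp
  also have "\<dots> = ennreal (1 / real T * sqrt (12 * R.H T * (m + real T) powr (1/3) * real T))"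
    using R.H_nonneg by (intro ennreal_mult[symmetric]) auto
  also have "\<dots> \<le> ennreal (2 * sqrt (3 * R.H T) * m powr (1/6) / real T powr (1/2)
      + 2 * sqrt (3 * R.H T) / real T powr (1/3))"
    by (intro ennreal_leI R.rate_bound T_ge)
  finally have 2: "ennreal (1 / real T) * (\<Sum>t=1..T. \<integral>\<^sup>+s. ennreal (G s t) \<partial>stream_space D) \<le> \<dots>" .
  show ?thesis
    unfolding Let_def
    using R.F_differentiable 1 2
    unfolding G_def X_def Y_def W_def R.H_def R.Fstar_def by blast
qed

end
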